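(* Let $e,\ell\ge 2$ and $n\ge 0$ be integers, let $\mathbf{s}=(s_1,\dots,s_\ell)\in\mathbb{Z}^\ell$ be normalized so that $s_1=n-e-1$, and let $\mathrm{Triv}$ denote the $\ell$-partition $((1^n),\emptyset,\dots,\emptyset)$. Let $q(\mathrm{Triv})$ and $p(\mathrm{Triv})$ denote the depth of the abacus $\mathcal{A}(\mathrm{Triv},\mathbf{s})$ in the $\mathfrak{sl}_\infty$-crystal and in the $\widehat{\mathfrak{sl}_e}$-crystal, respectively. Write $n=qe+r$ with $q,r\in\mathbb{Z}_{\ge0}$ and $r<e$, and set $$m=\min\left(\{n \bmod e\}\cup\{s_j \bmod e\mid 2\le j\le\ell,\ s_j\ge 0\}\right).$$ Then $$q(\mathrm{Triv})=\begin{cases} q & \text{if } s_j<0\text{ for all }j\ge 2,\\ 0 & \text{if } s_j\ge 0\text{ for some }j\ge 2,\end{cases}\qquad p(\mathrm{Triv})=\begin{cases} r & \text{if } s_j<0\text{ for all }j\ge 2,\\ m & \text{if } s_j\ge 0\text{ for some }j\ge 2.\end{cases}$$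
   Context: Throughout $e,\ell\ge 2$ are fixed integers and $\mathbb{N}=\{1,2,\dots\}$. Residues mod $e$ are taken in $\{0,\dots,e-1\}$. Abaci. An $\ell$-abacus is a subset $\mathcal{A}\subset\mathbb{Z}\times\{1,\dots,\ell\}$ such that for some $m_-,m_+\in\mathbb{Z}$ and all $j$: $(\beta,j)\in\mathcal{A}$ for all $\beta\le m_-$ and $(\beta,j)\notin\mathcal{A}$ for all $\beta\ge m_+$. Elements $b=(\beta,j)\in\mathcal{A}$ are beads, in column $\beta(b)=\beta$ and row $j(b)=j$ (row 1 is the bottom row); pairs not in $\mathcal{A}$ are spaces. For $\mathbf{s}\in\mathbb{Z}^\ell$ and an $\ell$-partition $\boldsymbol\lambda=(\lambda^1,\dots,\lambda^\ell)$ put $\mathcal{A}(\boldsymbol\lambda,\mathbf{s})=\{(\lambda^j_k+s_j-k+1,j)\mid 1\le j\le\ell,\ k\ge 1\}$. Every $\ell$-abacus is of this form for a unique pair $(\boldsymbol\lambda,\mathbf{s})$; $\mathbf{s}$ is its charge. Quasiperiods and fore periods. Beads are totally ordered by: $b<b'$ iff $\beta(b)<\beta(b')$, or $\beta(b)=\beta(b')$ and $j(b)>j(b')$. An $e$-quasiperiod (quasiperiod) of $\mathcal{A}$ is a sequence of $e$ beads $(b_1,\dots,b_e)$ with $\beta(b_{i+1})=\beta(b_i)-1$ and $j(b_i)\ge j(b_{i+1})$ for $1\le i\le e-1$. Quasiperiods are ordered lexicographically. The first fore period $P_1$ of $\mathcal{A}$ is its largest quasiperiod; inductively the $k$'th fore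 period $P_k$ is the largest quasiperiod with $P_k<P_{k-1}$ and $P_k\cap P_i=\emptyset$ for all $i<k$. Shifting $P$ one unit to the right means replacing $\mathcal{A}$ by $(\mathcal{A}\setminus P)\cup\tilde P$, $\tilde P=\{(\beta+1,j)\mid(\beta,j)\in P\}$. The $\mathfrak{sl}_\infty$-crystal. For a partition $\sigma=(\sigma_1\ge\sigma_2\ge\cdots)$, the operator $\tilde b_\sigma$ acts on $\ell$-abaci (preserving charge) by shifting the first fore period (of the current abacus) one unit to the right $\sigma_1$ times, then shifting the second fore period (of the current abacus) one unit to the right $\sigma_2$ times, and so on (these shifts are always defined). An abacus is a highest weight vertex for $\mathfrak{sl}_\infty$ if it is not of the form $\tilde b_\sigma\mathcal{B}$ with $\sigma\ne\emptyset$. It is known that every $\ell$-abacus is $\mathcal{A}=\tilde b_\theta\mathcal{A}^\circ$ for a unique partition $\theta$ and a unique highest weight vertex $\mathcal{A}^\circ$. The $\mathfrak{sl}_\infty$-crystal has an arrow $\tilde b_\theta\mathcal{A}^\circ\to\tilde b_\rho\mathcal{A}^\circ$ whenever $\rho$ is obtained from $\theta$ by adding one box. The depth of $\mathcal{A}$ in the $\mathfrak{sl}_\infty$-crystal is $|\theta|$. The $\widehat{\mathfrak{sl}_e}$-crystal. A bead $(\beta,j)\in\mathcal{A}$ is a right-shiftable $i$-bead if $(\beta+1,j)\notin\mathcal{A}$ and $i=\beta\bmod e$; it is then given position $(\beta,j)$. It is a left-shiftable $i$-bead if $(\beta-1,j)\notin\mathcal{A}$ and $i=(\beta-1)\bmod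 e$; it is then given position $(\beta-1,j)$. For fixed $i$, list all left- and right-shiftable $i$-beads in increasing order of positions, where $(\beta,j)<(\beta',j')$ iff $\beta<\beta'$ or ($\beta=\beta'$ and $j>j'$); write $-$ for left-shiftable and $+$ for right-shiftable, and recursively delete all subwords $-+$ to obtain a word $+\cdots+-\cdots-$. The good right-shiftable $i$-bead is the one of the rightmost remaining $+$ (if any). There is an arrow $\mathcal{A}\xrightarrow{i}\mathcal{A}'$ iff $\mathcal{A}'$ is obtained from $\mathcal{A}$ by moving its good right-shiftable $i$-bead one column to the right. Each connected component has a unique source vertex, and the depth of $\mathcal{A}$ in the $\widehat{\mathfrak{sl}_e}$-crystal is the length of a directed path from the source of its component to $\mathcal{A}$. *)

theory Defs
  imports Main
begin

section \<open>Abaci\<close>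

text \<open>A bead is a pair (column, row); the rows of an \<open>l\<close>-abacus are numbered from 1.\<close>

type_synonym bead = "int \<times> nat"
type_synonym abacus = "bead set"

definition is_abacus :: "nat \<Rightarrow> abacus \<Rightarrow> bool" where
  "is_abacus l A \<longleftrightarrow> A \<subseteq> UNIV \<times> {1..l} \<and>
     (\<exists>m1 m2. \<forall>j\<in>{1..l}. (\<forall>\<beta>\<le>m1. (\<beta>, j) \<in> A) \<and> (\<forall>\<beta>\<ge>m2. (\<beta>, j) \<notin> A))"

text \<open>Partitions are weakly decreasing lists of positive numbers; \<open>part \<sigma> k\<close> is the
  \<open>k\<close>-th part, counted from \<open>k = 1\<close>, and is 0 beyond the last one.\<close>

definition is_partition :: "nat list \<Rightarrow> bool" where
  "is_partition \<sigma> \<longleftrightarrow> sorted_wrt (\<ge>) \<sigma> \<and> (\<forall>x\<in>set \<sigma>. x > 0)"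

definition part :: "nat list \<Rightarrow> nat \<Rightarrow> nat" where
  "part \<sigma> k = (if 1 \<le> k \<and> k \<le> length \<sigma> then \<sigma> ! (k - 1) else 0)"

text \<open>Multipartitions and charges are families indexed by \<open>1, \<dots>, l\<close>; values at other
  indices are ignored.\<close>

definition abacus_of :: "nat \<Rightarrow> (nat \<Rightarrow> nat list) \<Rightarrow> (nat \<Rightarrow> int) \<Rightarrow> abacus" where
  "abacus_of l lam s =
     {(int (part (lam j) k) + s j - int k + 1, j) | j k. 1 \<le> j \<and> j \<le> l \<and> 1 \<le> k}"

definition Triv :: "nat \<Rightarrow> nat \<Rightarrow> nat list" where
  "Triv n = (\<lambda>j. if j = 1 then replicate n 1 else [])"

text \<open>The strict order on beads, also used for positions. In a given column the bead in
  the lower row is the larger one.\<close>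

definition bead_less :: "(bead \<times> bead) set" where
  "bead_less = {((\<beta>, j), (\<beta>', j')). \<beta> < \<beta>' \<or> (\<beta> = \<beta>' \<and> j > j')}"


section \<open>Quasiperiods and fore periods\<close>

definition quasiperiod :: "nat \<Rightarrow> abacus \<Rightarrow> bead list \<Rightarrow> bool" where
  "quasiperiod e A P \<longleftrightarrow> length P = e \<and> set P \<subseteq> A \<and>
     (\<forall>i. Suc i < e \<longrightarrow>
        fst (P ! Suc i) = fst (P ! i) - 1 \<and> snd (P ! i) \<ge> snd (P ! Suc i))"

definition largest_seq :: "bead list set \<Rightarrow> bead list \<Rightarrow> bool" where
  "largest_seq S P \<longleftrightarrow> P \<in> S \<and> (\<forall>Q\<in>S. Q \<noteq> P \<longrightarrow> (Q, P) \<in> lexord bead_less)"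

text \<open>\<open>fore_period e A k\<close> is the \<open>k\<close>-th fore period for \<open>k \<ge> 1\<close>; the value at
  \<open>k = 0\<close> has no meaning.\<close>

function fore_period :: "nat \<Rightarrow> abacus \<Rightarrow> nat \<Rightarrow> bead list" where
  "fore_period e A k = (THE P. largest_seq {Q. quasiperiod e A Q \<and>
       (k > 1 \<longrightarrow> (Q, fore_period e A (k - 1)) \<in> lexord bead_less) \<and>
       (\<forall>i\<in>{1..<k}. set Q \<inter> set (fore_period e A i) = {})} P)"
  by pat_completeness auto
termination
  by (relation "measure (\<lambda>(e, A, k). k)") auto

declare fore_period.simps [simp del]

definition shift_right :: "bead list \<Rightarrow> abacus \<Rightarrow> abacus" where
  "shift_right P A = (A - set P) \<union> (\<lambda>(\<beta>, j). (\<beta> + 1, j)) ` set P"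


section \<open>The crystal of type \<open>sl_infinity\<close>\<close>

definition b_tilde :: "nat \<Rightarrow> nat list \<Rightarrow> abacus \<Rightarrow> abacus" where
  "b_tilde e \<sigma> A =
     fold (\<lambda>k. (\<lambda>B. shift_right (fore_period e B k) B) ^^ part \<sigma> k) [1..<Suc (length \<sigma>)] A"

definition sl_inf_highest_weight :: "nat \<Rightarrow> nat \<Rightarrow> abacus \<Rightarrow> bool" where
  "sl_inf_highest_weight e l A \<longleftrightarrow> is_abacus l A \<and>
     \<not> (\<exists>\<sigma> B. is_partition \<sigma> \<and> \<sigma> \<noteq> [] \<and> is_abacus l B \<and> A = b_tilde e \<sigma> B)"

definition sl_inf_depth :: "nat \<Rightarrow> nat \<Rightarrow> abacus \<Rightarrow> nat" where
  "sl_inf_depth e l A = (THE d. \<exists>\<theta> B. is_partition \<theta> \<and> sl_inf_highest_weight e l B \<and>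
     A = b_tilde e \<theta> B \<and> d = sum_list \<theta>)"


section \<open>The crystal of affine type \<open>sl_e\<close>\<close>

datatype sign = Plus | Minus

text \<open>All left- and right-shiftable \<open>i\<close>-beads, given by position and sign. A right-shiftable
  bead has itself as position, a left-shiftable one the place to its left.\<close>

definition signed_positions :: "nat \<Rightarrow> abacus \<Rightarrow> nat \<Rightarrow> (bead \<times> sign) set" where
  "signed_positions e A i =
     {((\<beta>, j), Plus) | \<beta> j. (\<beta>, j) \<in> A \<and> (\<beta> + 1, j) \<notin> A \<and> \<beta> mod int e = int i} \<union>
     {((\<beta> - 1, j), Minus) | \<beta> j. (\<beta>, j) \<in> A \<and> (\<beta> - 1, j) \<notin> A \<and> (\<beta> - 1) mod int e = int i}"

definition signature :: "nat \<Rightarrow> abacus \<Rightarrow> nat \<Rightarrow> (bead \<times> sign) list" where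
  "signature e A i = (THE w. sorted_wrt (\<lambda>x y. (fst x, fst y) \<in> bead_less) w \<and>
     set w = signed_positions e A i)"

inductive cancel :: "(bead \<times> sign) list \<Rightarrow> (bead \<times> sign) list \<Rightarrow> bool" where
  "cancel (u @ [(p, Minus), (p', Plus)] @ v) (u @ v)"

definition good_bead :: "nat \<Rightarrow> abacus \<Rightarrow> nat \<Rightarrow> bead \<Rightarrow> bool" where
  "good_bead e A i b \<longleftrightarrow> (\<exists>u v. cancel\<^sup>*\<^sup>* (signature e A i) (u @ [(b, Plus)] @ v) \<and>
     (\<forall>x\<in>set u. snd x = Plus) \<and> (\<forall>x\<in>set v. snd x = Minus))"

definition sl_e_arrow :: "nat \<Rightarrow> nat \<Rightarrow> abacus \<Rightarrow> abacus \<Rightarrow> bool" where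
  "sl_e_arrow e l A A' \<longleftrightarrow> is_abacus l A \<and>
     (\<exists>i<e. \<exists>\<beta> j. good_bead e A i (\<beta>, j) \<and> A' = (A - {(\<beta>, j)}) \<union> {(\<beta> + 1, j)})"

definition sl_e_source :: "nat \<Rightarrow> nat \<Rightarrow> abacus \<Rightarrow> bool" where
  "sl_e_source e l A \<longleftrightarrow> is_abacus l A \<and> \<not> (\<exists>B. sl_e_arrow e l B A)"

text \<open>Being in the same connected component is the equivalence closure of the arrow relation.\<close>

definition sl_e_depth :: "nat \<Rightarrow> nat \<Rightarrow> abacus \<Rightarrow> nat" where
  "sl_e_depth e l A = (THE d. \<exists>B. sl_e_source e l B \<and> equivclp (sl_e_arrow e l) B A \<and>
     (sl_e_arrow e l ^^ d) B A)"

end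

theory Submission
  imports Defs
begin

text \<open>
  Write \<open>N = n - e\<close> and let \<open>G c\<close> be the abacus whose row \<open>1\<close> contains all columns up to
  \<open>N\<close> except \<open>c\<close>, and whose row \<open>j \<ge> 2\<close> contains all columns up to \<open>s j\<close>
  (\<open>gap_abacus\<close>). The abacus of \<open>Triv n\<close> with the normalized charge is \<open>G (-e)\<close>. In \<open>G c\<close>
  at most one bead can move to the left, namely the one just right of the gap. Hence in both
  crystals there is at most one way back from \<open>G c\<close>, and both depths are found by following it.
  The uniqueness of sources and of highest weight vertices is not needed in general: it comes
  out for this particular abacus.

  For affine \<open>sl_e\<close>, an arrow into \<open>G c\<close> can only start at \<open>G (c + 1)\<close>. In that abacus no
  bead can move left onto a position of residue \<open>c mod e\<close>, so the signature has no cancellation, and the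
  arrow exists iff \<open>c < N\<close> and none of the numbers \<open>N, s 2, \<dots>, s l\<close> exceeds \<open>c\<close> and is
  congruent to it (\<open>gap_moves\<close>, \<open>sl_e_arrow_gap_abacus_iff\<close>). Starting from \<open>c = -e\<close> the gap
  moves right until this fails, which happens after exactly \<open>m\<close> steps; if all
  \<open>s j\<close> with \<open>j \<ge> 2\<close> are negative, then \<open>m = r\<close>.

  For \<open>sl_infinity\<close>, suppose that shifting a quasiperiod of \<open>C\<close> to the right yields \<open>G c\<close>. The
  last bead of the quasiperiod leaves a space behind, so it came from the gap, and
  going back up the quasiperiod shows that it is the block of columns \<open>c, \<dots>, c + e - 1\<close> of
  row \<open>1\<close>. So \<open>C = G (c + e)\<close>, or \<open>C\<close> has no gap at all if the shift made two beads
  collide (\<open>shift_right_eq_gap_abacus\<close>). An abacus without gaps is never the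
  result of a shift, and its first fore period is too large to be such a block, so the second
  case does not occur along \<open>b_tilde e \<sigma> B\<close>. Therefore \<open>b_tilde e \<sigma> B = G c\<close> forces
  \<open>B = G (c + e * \<bar>\<sigma>\<bar>)\<close>, where \<open>c + e * \<bar>\<sigma>\<bar> \<le> N\<close> unless \<open>\<sigma>\<close> is empty; moreover, at every
  stage the fore period that is shifted is the block of row \<open>1\<close> just left of the gap
  (\<open>b_tilde_eq_gap_abacus\<close>).

  If all \<open>s j\<close> with \<open>j \<ge> 2\<close> are negative, the column of length \<open>q\<close> leads from
  \<open>G ((q - 1) * e)\<close> to \<open>G (-e)\<close>, and \<open>G ((q - 1) * e)\<close> has highest weight because
  \<open>(q - 1) * e + e > N\<close>. If some \<open>s j\<close> is nonnegative, \<open>G (-e)\<close> is itself of highest weight: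
  otherwise choose \<open>j\<close> with \<open>s j\<close> maximal. On the way to \<open>G (-e)\<close> the gap is at some multiple
  \<open>c \<ge> 0\<close> of \<open>e\<close> with \<open>c \<le> s j\<close>, where all earlier fore periods lie
  in row \<open>1\<close> to the right of the gap. Then \<open>(c, j), (c - 1, 1), (c - 2, 1), \<dots>\<close> is
  disjoint from them and larger than the block just left of the gap, a contradiction.
\<close>

section \<open>The orders on beads and on sequences of beads\<close>

lemma bead_less_irrefl: "(b, b) \<notin> bead_less"
  by (auto simp: bead_less_def)

lemma trans_bead_less: "trans bead_less"
  by (rule transI) (auto simp: bead_less_def)

lemma bead_less_linear: "(a, b) \<in> bead_less \<or> a = b \<or> (b, a) \<in> bead_less"
  by (cases a; cases b) (auto simp: bead_less_def)

lemma bead_less_asym: "(a, b) \<in> bead_less \<Longrightarrow> (b, a) \<notin> bead_less"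
  by (auto simp: bead_less_def)

lemma lexord_bead_less_linear:
  "(P, Q) \<in> lexord bead_less \<or> P = Q \<or> (Q, P) \<in> lexord bead_less"
  by (rule lexord_linear) (use bead_less_linear in blast)

lemma lexord_bead_less_irrefl: "(P, P) \<notin> lexord bead_less"
  by (rule lexord_irreflexive) (simp add: bead_less_irrefl)

lemma lexord_bead_less_trans:
  "(P, Q) \<in> lexord bead_less \<Longrightarrow> (Q, R) \<in> lexord bead_less \<Longrightarrow> (P, R) \<in> lexord bead_less"
  using lexord_trans trans_bead_less by blast

lemma lexord_bead_less_asym:
  "(P, Q) \<in> lexord bead_less \<Longrightarrow> (Q, P) \<notin> lexord bead_less"
  using lexord_bead_less_trans lexord_bead_less_irrefl by blast

lemma largest_seq_unique: "largest_seq S P \<Longrightarrow> largest_seq S Q \<Longrightarrow> P = Q"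
  unfolding largest_seq_def by (metis lexord_bead_less_asym)

lemma finite_largest_seq:
  assumes "finite S" "S \<noteq> {}"
  shows "\<exists>P. largest_seq S P"
  using assms
proof (induction rule: finite_ne_induct)
  case (singleton x)
  then show ?case by (auto simp: largest_seq_def)
next
  case (insert x F)
  then obtain P where P: "largest_seq F P" by blast
  show ?case
  proof (cases "(P, x) \<in> lexord bead_less")
    case True
    then have "largest_seq (insert x F) x"
      using P unfolding largest_seq_def by (metis insert_iff lexord_bead_less_trans)
    then show ?thesis ..
  next
    case False
    then have "largest_seq (insert x F) P"
      using P unfolding largest_seq_def by (metis insert_iff lexord_bead_less_linear)
    then show ?thesis ..
  qed
qed


section \<open>Quasiperiods and fore periods of an arbitrary abacus\<close>

lemma quasiperiod_length: "quasiperiod e A P \<Longrightarrow> length P = e"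
  by (simp add: quasiperiod_def)

lemma quasiperiod_nth_mem: "quasiperiod e A P \<Longrightarrow> i < e \<Longrightarrow> P ! i \<in> A"
  unfolding quasiperiod_def using nth_mem by blast

lemma quasiperiod_column:
  assumes "quasiperiod e A P" "i < e"
  shows "fst (P ! i) = fst (P ! 0) - int i"
  using assms(2)
proof (induction i)
  case (Suc i)
  then have "fst (P ! Suc i) = fst (P ! i) - 1"
    using assms(1) by (auto simp: quasiperiod_def)
  with Suc show ?case by simp
qed simp

lemma quasiperiod_row:
  assumes "quasiperiod e A P" "i < e"
  shows "snd (P ! i) \<le> snd (P ! 0)"
  using assms(2)
proof (induction i)
  case (Suc i)
  then have "snd (P ! Suc i) \<le> snd (P ! i)"
    using assms(1) by (auto simp: quasiperiod_def)
  with Suc show ?case by simp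
qed simp

text \<open>The quasiperiod in row \<open>1\<close> that occupies the columns \<open>c, \<dots>, c + e - 1\<close>, listed from
  right to left.\<close>

definition row_period :: "nat \<Rightarrow> int \<Rightarrow> bead list" where
  "row_period e c = map (\<lambda>i. (c + int e - 1 - int i, 1)) [0..<e]"

lemma length_row_period [simp]: "length (row_period e c) = e"
  by (simp add: row_period_def)

lemma row_period_nth: "i < e \<Longrightarrow> row_period e c ! i = (c + int e - 1 - int i, 1)"
  by (simp add: row_period_def)

lemma set_row_period: "set (row_period e c) = {c..<c + int e} \<times> {1}"
proof -
  have "(x, 1) \<in> set (row_period e c)" if "c \<le> x" "x < c + int e" for x
  proof -
    have "(x, 1::nat) = (c + int e - 1 - int (nat (c + int e - 1 - x)), 1)"
      using that by simp
    moreover have "nat (c + int e - 1 - x) \<in> set [0..<e]" using that by auto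
    ultimately show ?thesis unfolding row_period_def set_map by (rule image_eqI)
  qed
  moreover have "set (row_period e c) \<subseteq> {c..<c + int e} \<times> {1}"
    by (auto simp: row_period_def)
  ultimately show ?thesis by auto
qed

lemma quasiperiod_row_period:
  assumes "{c..<c + int e} \<times> {1} \<subseteq> A"
  shows "quasiperiod e A (row_period e c)"
  using assms by (simp add: quasiperiod_def set_row_period row_period_nth)

text \<open>A quasiperiod never goes up, so one that starts in row \<open>1\<close> stays there.\<close>

lemma quasiperiod_eq_row_period:
  assumes "quasiperiod e A Q" "A \<subseteq> UNIV \<times> {1..l}" "0 < e" "Q ! 0 = (c + int e - 1, 1)"
  shows "Q = row_period e c"
proof (rule nth_equalityI)
  show "length Q = length (row_period e c)" using quasiperiod_length[OF assms(1)] by simp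
  fix i assume "i < length Q"
  then have i: "i < e" using quasiperiod_length[OF assms(1)] by simp
  have "snd (Q ! i) \<ge> 1" using quasiperiod_nth_mem[OF assms(1) i] assms(2) by auto
  then have "snd (Q ! i) = 1" using quasiperiod_row[OF assms(1) i] assms(4) by simp
  moreover have "fst (Q ! i) = c + int e - 1 - int i"
    using quasiperiod_column[OF assms(1) i] assms(4) by simp
  ultimately show "Q ! i = row_period e c ! i" using i by (simp add: row_period_nth prod_eq_iff)
qed

lemma lexord_of_first:
  assumes "(P ! 0, Q ! 0) \<in> bead_less" "length P = e" "length Q = e" "0 < e"
  shows "(P, Q) \<in> lexord bead_less"
  using assms by (cases P; cases Q) auto

lemma quasiperiod_less_row_period:
  assumes "quasiperiod e A Q" "A \<subseteq> UNIV \<times> {1..l}" "0 < e"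
    and "fst (Q ! 0) \<le> c + int e - 1" "Q \<noteq> row_period e c"
  shows "(Q, row_period e c) \<in> lexord bead_less"
proof (rule lexord_of_first)
  have "Q ! 0 \<noteq> (c + int e - 1, 1)"
    using quasiperiod_eq_row_period[OF assms(1-3)] assms(5) by blast
  moreover have "snd (Q ! 0) \<ge> 1"
    using quasiperiod_nth_mem[OF assms(1,3)] assms(2) by auto
  ultimately show "(Q ! 0, row_period e c ! 0) \<in> bead_less"
    using assms(3,4) by (cases "Q ! 0") (auto simp: bead_less_def row_period_nth)
qed (use assms quasiperiod_length in auto)

text \<open>Such quasiperiods exist far to the left in row \<open>1\<close>. Only finitely many start at least as
  far right as a given one, since columns far to the right are empty.\<close>

lemma ex_largest_quasiperiod:
  assumes A: "is_abacus l A" and l: "1 \<le> l" and e: "0 < e" and X: "finite X"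
  shows "\<exists>P. largest_seq {Q. quasiperiod e A Q \<and> set Q \<inter> X = {}} P"
proof -
  let ?S = "{Q. quasiperiod e A Q \<and> set Q \<inter> X = {}}"
  obtain m1 m2 where A1: "A \<subseteq> UNIV \<times> {1..l}"
    and m1: "\<And>j \<beta>. j \<in> {1..l} \<Longrightarrow> \<beta> \<le> m1 \<Longrightarrow> (\<beta>, j) \<in> A"
    and m2: "\<And>j \<beta>. j \<in> {1..l} \<Longrightarrow> \<beta> \<ge> m2 \<Longrightarrow> (\<beta>, j) \<notin> A"
    using A unfolding is_abacus_def by blast
  define x0 where "x0 = Min (insert m1 (fst ` X))"
  have x0: "x0 \<le> m1" "\<And>b. b \<in> X \<Longrightarrow> x0 \<le> fst b"
    using X unfolding x0_def by (auto intro!: Min_le)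
  define Q0 where "Q0 = row_period e (x0 - int e)"
  have "quasiperiod e A Q0"
    unfolding Q0_def by (rule quasiperiod_row_period) (use x0 l m1 in auto)
  moreover have "set Q0 \<inter> X = {}"
    using x0(2) by (fastforce simp: Q0_def set_row_period)
  ultimately have Q0: "Q0 \<in> ?S" by simp
  let ?F = "{Q \<in> ?S. fst (Q ! 0) \<ge> x0 - 1}"
  have "Q0 \<in> ?F" using Q0 e by (simp add: Q0_def row_period_nth)
  moreover have "finite ?F"
  proof (rule finite_subset)
    show "?F \<subseteq> {Q. set Q \<subseteq> {x0 - int e..m2} \<times> {1..l} \<and> length Q = e}"
    proof
      fix Q assume Q: "Q \<in> ?F"
      then have q: "quasiperiod e A Q" and x: "fst (Q ! 0) \<ge> x0 - 1" by auto
      have "b \<in> {x0 - int e..m2} \<times> {1..l}" if "b \<in> set Q" for b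
      proof -
        obtain i where "i < length Q" "b = Q ! i"
          using \<open>b \<in> set Q\<close> by (auto simp: in_set_conv_nth)
        then have i: "i < e" "b = Q ! i" using quasiperiod_length[OF q] by simp_all
        have b: "b \<in> A" using i quasiperiod_nth_mem[OF q] by simp
        then have "snd b \<in> {1..l}" using A1 by auto
        moreover have "fst b < m2"
          using b m2[of "snd b" "fst b"] calculation by (cases "fst b < m2") auto
        moreover have "fst b \<ge> x0 - int e"
          using quasiperiod_column[OF q i(1)] i x by simp
        ultimately show ?thesis by (cases b) auto
      qed
      then show "Q \<in> {Q. set Q \<subseteq> {x0 - int e..m2} \<times> {1..l} \<and> length Q = e}"
        using quasiperiod_length[OF q] by blast
    qed
    show "finite {Q. set Q \<subseteq> {x0 - int e..m2} \<times> {1..l} \<and> length Q = e}"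
      by (rule finite_lists_length_eq) simp
  qed
  ultimately obtain P where P: "largest_seq ?F P"
    using finite_largest_seq[of ?F] by blast
  have "largest_seq ?S P"
    unfolding largest_seq_def
  proof (intro conjI ballI impI)
    show "P \<in> ?S" using P by (auto simp: largest_seq_def)
    fix Q assume Q: "Q \<in> ?S" "Q \<noteq> P"
    show "(Q, P) \<in> lexord bead_less"
    proof (cases "fst (Q ! 0) \<ge> x0 - 1")
      case True
      then show ?thesis using P Q by (auto simp: largest_seq_def)
    next
      case False
      have "P \<in> ?F" using P by (simp add: largest_seq_def)
      then have "(Q ! 0, P ! 0) \<in> bead_less"
        using False by (cases "Q ! 0"; cases "P ! 0") (auto simp: bead_less_def)
      then show ?thesis
        using lexord_of_first e Q \<open>P \<in> ?F\<close> by (auto simp: quasiperiod_def)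
    qed
  qed
  then show ?thesis ..
qed

text \<open>The requirement that the \<open>k\<close>-th fore period be smaller than the previous one is redundant:
  it follows from disjointness, by the choice of the previous one as the largest.\<close>

lemma fore_period_largest:
  assumes A: "is_abacus l A" and l: "1 \<le> l" and e: "0 < e" and k: "1 \<le> k"
  shows "largest_seq {Q. quasiperiod e A Q \<and> (\<forall>i\<in>{1..<k}. set Q \<inter> set (fore_period e A i) = {})}
    (fore_period e A k)"
  using k
proof (induction k rule: less_induct)
  case (less k)
  let ?S = "\<lambda>k. {Q. quasiperiod e A Q \<and> (\<forall>i\<in>{1..<k}. set Q \<inter> set (fore_period e A i) = {})}"
  let ?T = "{Q. quasiperiod e A Q \<and>
       (k > 1 \<longrightarrow> (Q, fore_period e A (k - 1)) \<in> lexord bead_less) \<and>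
       (\<forall>i\<in>{1..<k}. set Q \<inter> set (fore_period e A i) = {})}"
  have "(Q, fore_period e A (k - 1)) \<in> lexord bead_less" if Q: "Q \<in> ?S k" and k1: "k > 1" for Q
  proof -
    have "largest_seq (?S (k - 1)) (fore_period e A (k - 1))"
      using less.IH[of "k - 1"] k1 by simp
    moreover have "Q \<in> ?S (k - 1)"
      using Q less_le_trans[OF _ diff_le_self[of k 1]] by fastforce
    moreover have "Q \<noteq> fore_period e A (k - 1)"
    proof
      assume "Q = fore_period e A (k - 1)"
      moreover have "k - 1 \<in> {1..<k}" using k1 by auto
      ultimately have "set Q \<inter> set Q = {}" using Q by blast
      then show False using Q e by (auto simp: quasiperiod_def)
    qed
    ultimately show ?thesis by (auto simp: largest_seq_def)
  qed
  then have eq: "?T = ?S k" by blast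
  have "?S k = {Q. quasiperiod e A Q \<and> set Q \<inter> (\<Union>i\<in>{1..<k}. set (fore_period e A i)) = {}}"
    by blast
  then obtain P where "largest_seq (?S k) P"
    using ex_largest_quasiperiod[OF A l e, of "\<Union>i\<in>{1..<k}. set (fore_period e A i)"] by auto
  then have "largest_seq (?S k) (THE P. largest_seq (?S k) P)"
    by (rule theI) (rule largest_seq_unique[OF _ \<open>largest_seq (?S k) P\<close>])
  moreover have "fore_period e A k = (THE P. largest_seq (?S k) P)"
    using fore_period.simps[of e A k] unfolding eq .
  ultimately show ?case by simp
qed

lemma fore_period_quasiperiod:
  assumes "is_abacus l A" "1 \<le> l" "0 < e" "1 \<le> k"
  shows "quasiperiod e A (fore_period e A k)"
  using fore_period_largest[OF assms] by (auto simp: largest_seq_def)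

lemma fore_period_eqI:
  assumes "is_abacus l A" "1 \<le> l" "0 < e" "1 \<le> k"
    and "quasiperiod e A P" "\<And>i. 1 \<le> i \<Longrightarrow> i < k \<Longrightarrow> set P \<inter> set (fore_period e A i) = {}"
    and "\<And>Q. quasiperiod e A Q \<Longrightarrow> (\<And>i. 1 \<le> i \<Longrightarrow> i < k \<Longrightarrow> set Q \<inter> set (fore_period e A i) = {})
      \<Longrightarrow> Q \<noteq> P \<Longrightarrow> (Q, P) \<in> lexord bead_less"
  shows "fore_period e A k = P"
  by (rule largest_seq_unique[OF fore_period_largest[OF assms(1-4)]])
    (use assms(5-7) in \<open>auto simp: largest_seq_def\<close>)

lemma fore_period_not_less:
  assumes "is_abacus l A" "1 \<le> l" "0 < e" "1 \<le> k"
    and "quasiperiod e A Q" "\<And>i. 1 \<le> i \<Longrightarrow> i < k \<Longrightarrow> set Q \<inter> set (fore_period e A i) = {}"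
  shows "(fore_period e A k, Q) \<notin> lexord bead_less"
proof -
  have "Q \<in> {Q. quasiperiod e A Q \<and> (\<forall>i\<in>{1..<k}. set Q \<inter> set (fore_period e A i) = {})}"
    using assms(5,6) by simp
  then have "Q = fore_period e A k \<or> (Q, fore_period e A k) \<in> lexord bead_less"
    using fore_period_largest[OF assms(1-4)] unfolding largest_seq_def by blast
  then show ?thesis using lexord_bead_less_asym lexord_bead_less_irrefl by metis
qed

lemma is_abacus_shift_right:
  assumes "is_abacus l A" "quasiperiod e A P"
  shows "is_abacus l (shift_right P A)"
proof -
  obtain m1 m2 where A1: "A \<subseteq> UNIV \<times> {1..l}"
    and m1: "\<And>j \<beta>. j \<in> {1..l} \<Longrightarrow> \<beta> \<le> m1 \<Longrightarrow> (\<beta>, j) \<in> A"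
    and m2: "\<And>j \<beta>. j \<in> {1..l} \<Longrightarrow> \<beta> \<ge> m2 \<Longrightarrow> (\<beta>, j) \<notin> A"
    using assms(1) unfolding is_abacus_def by blast
  have P: "set P \<subseteq> A" using assms(2) by (simp add: quasiperiod_def)
  define x0 where "x0 = Min (insert m1 (fst ` set P)) - 1"
  have x0: "x0 + 1 \<le> y" if "y \<in> insert m1 (fst ` set P)" for y
  proof -
    have "Min (insert m1 (fst ` set P)) \<le> y" by (rule Min_le) (use that in auto)
    then show ?thesis by (simp add: x0_def)
  qed
  have "(\<beta>, j) \<in> shift_right P A" if "j \<in> {1..l}" "\<beta> \<le> x0" for \<beta> j
    using m1[OF that(1), of \<beta>] x0[of m1] x0[of \<beta>] that(2)
    by (force simp: shift_right_def)
  moreover have "(\<beta>, j) \<notin> shift_right P A" if "j \<in> {1..l}" "\<beta> \<ge> m2 + 1" for \<beta> j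
    using m2[OF that(1), of \<beta>] m2[OF that(1), of "\<beta> - 1"] P that(2)
    by (auto simp: shift_right_def)
  moreover have "shift_right P A \<subseteq> UNIV \<times> {1..l}"
    using A1 P by (auto simp: shift_right_def)
  ultimately show ?thesis unfolding is_abacus_def by blast
qed


section \<open>Abaci with a single gap\<close>

text \<open>Row \<open>1\<close> is filled up to column \<open>N\<close> except for the gap \<open>c\<close>, and row \<open>j \<ge> 2\<close> is filled
  up to column \<open>s j\<close>. For \<open>c > N\<close> there is no gap; \<open>c = N + 1\<close> is used to denote this case.\<close>

definition gap_abacus :: "nat \<Rightarrow> (nat \<Rightarrow> int) \<Rightarrow> int \<Rightarrow> int \<Rightarrow> abacus" where
  "gap_abacus l s N c =
     {(\<beta>, j). 1 \<le> j \<and> j \<le> l \<and> \<beta> \<le> (if j = 1 then N else s j) \<and> (\<beta>, j) \<noteq> (c, 1)}"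

lemma gap_abacus_iff:
  "(\<beta>, j) \<in> gap_abacus l s N c \<longleftrightarrow>
     1 \<le> j \<and> j \<le> l \<and> \<beta> \<le> (if j = 1 then N else s j) \<and> (\<beta> \<noteq> c \<or> j \<noteq> 1)"
  by (auto simp: gap_abacus_def)

lemma gap_abacus_rows: "gap_abacus l s N c \<subseteq> UNIV \<times> {1..l}"
  by (auto simp: gap_abacus_def)

lemma is_abacus_gap_abacus: "is_abacus l (gap_abacus l s N c)"
proof -
  define m1 where "m1 = Min (insert (c - 1) (insert N (s ` {1..l})))"
  define m2 where "m2 = Max (insert N (s ` {1..l})) + 1"
  have m1: "m1 \<le> x" if "x \<in> insert (c - 1) (insert N (s ` {1..l}))" for x
    unfolding m1_def by (rule Min_le) (use that in auto)
  have m2: "x \<le> m2 - 1" if "x \<in> insert N (s ` {1..l})" for x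
    unfolding m2_def using Max_ge[of "insert N (s ` {1..l})" x] that by simp
  have "(\<beta>, j) \<in> gap_abacus l s N c" if "j \<in> {1..l}" "\<beta> \<le> m1" for \<beta> j
    using m1[of "c - 1"] m1[of N] m1[of "s j"] that by (auto simp: gap_abacus_iff)
  moreover have "(\<beta>, j) \<notin> gap_abacus l s N c" if "j \<in> {1..l}" "\<beta> \<ge> m2" for \<beta> j
    using m2[of N] m2[of "s j"] that by (auto simp: gap_abacus_iff)
  ultimately show ?thesis
    using gap_abacus_rows unfolding is_abacus_def by blast
qed

lemma abacus_of_Triv:
  assumes "1 \<le> l" "s 1 = int n - int e - 1"
  shows "abacus_of l (Triv n) s = gap_abacus l s (int n - int e) (- int e)"
proof -
  have part1: "part (Triv n 1) k = (if 1 \<le> k \<and> k \<le> n then 1 else 0)" for k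
    by (auto simp: part_def Triv_def)
  note part1' = part1[unfolded One_nat_def] and s1 = assms(2)[unfolded One_nat_def]
  have part2: "part (Triv n j) k = 0" if "j \<noteq> 1" for j k
    using that by (auto simp: part_def Triv_def)
  have "(\<beta>, j) \<in> abacus_of l (Triv n) s \<longleftrightarrow> (\<beta>, j) \<in> gap_abacus l s (int n - int e) (- int e)"
    for \<beta> j
  proof (cases "j = 1")
    case True
    have "(\<beta>, j) \<in> abacus_of l (Triv n) s \<longleftrightarrow>
        (\<exists>k\<ge>1. \<beta> = int (part (Triv n 1) k) + s 1 - int k + 1)"
      using True assms(1) by (auto simp: abacus_of_def)
    also have "\<dots> \<longleftrightarrow> \<beta> \<le> int n - int e \<and> \<beta> \<noteq> - int e"
    proof
      assume "\<exists>k\<ge>1. \<beta> = int (part (Triv n 1) k) + s 1 - int k + 1"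
      then show "\<beta> \<le> int n - int e \<and> \<beta> \<noteq> - int e"
        by (auto simp: part1' s1 split: if_splits)
    next
      assume b: "\<beta> \<le> int n - int e \<and> \<beta> \<noteq> - int e"
      show "\<exists>k\<ge>1. \<beta> = int (part (Triv n 1) k) + s 1 - int k + 1"
      proof (cases "\<beta> > - int e")
        case True
        then show ?thesis using b
          by (intro exI[of _ "nat (int n - int e - \<beta> + 1)"]) (auto simp: part1' s1)
      next
        case False
        then show ?thesis using b
          by (intro exI[of _ "nat (int n - int e - \<beta>)"]) (auto simp: part1' s1)
      qed
    qed
    finally show ?thesis using True assms(1) by (simp add: gap_abacus_iff)
  next
    case False
    have "(\<beta>, j) \<in> abacus_of l (Triv n) s \<longleftrightarrow>
        1 \<le> j \<and> j \<le> l \<and> (\<exists>k\<ge>1. \<beta> = s j - int k + 1)"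
      using False by (auto simp: abacus_of_def part2)
    also have "(\<exists>k\<ge>1. \<beta> = s j - int k + 1) \<longleftrightarrow> \<beta> \<le> s j"
    proof
      assume "\<beta> \<le> s j"
      then show "\<exists>k\<ge>1. \<beta> = s j - int k + 1"
        by (intro exI[of _ "nat (s j - \<beta> + 1)"]) auto
    qed auto
    finally show ?thesis using False by (simp add: gap_abacus_iff)
  qed
  then show ?thesis by auto
qed

lemma shift_right_iff:
  "(\<beta>, j) \<in> shift_right P A \<longleftrightarrow> (\<beta>, j) \<in> A \<and> (\<beta>, j) \<notin> set P \<or> (\<beta> - 1, j) \<in> set P"
  by (force simp: shift_right_def)

lemma shift_right_row_period:
  assumes "c \<le> N" "1 \<le> l" "0 < e"
  shows "shift_right (row_period e (c - int e)) (gap_abacus l s N c) = gap_abacus l s N (c - int e)"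
proof -
  have "(\<beta>, j) \<in> shift_right (row_period e (c - int e)) (gap_abacus l s N c) \<longleftrightarrow>
      (\<beta>, j) \<in> gap_abacus l s N (c - int e)" for \<beta> j
    using assms by (auto simp: shift_right_iff gap_abacus_iff set_row_period)
  then show ?thesis by auto
qed

section \<open>Undoing shifts of fore periods\<close>

text \<open>The second alternative for \<open>C\<close> is the case in which the first bead of the quasiperiod is
  shifted onto a bead that is already there.\<close>

lemma shift_right_eq_gap_abacus:
  assumes P: "quasiperiod e C P" and e: "0 < e"
    and eq: "shift_right P C = gap_abacus l s N c"
  shows "P = row_period e c" "c + int e \<le> N"
    and "C = gap_abacus l s N (c + int e) \<or> C = gap_abacus l s N (N + 1)"
proof -
  have PC: "set P \<subseteq> C" and len: "length P = e" using P by (auto simp: quasiperiod_def)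
  have right: "(fst (P ! i) + 1, snd (P ! i)) \<in> gap_abacus l s N c" if "i < e" for i
    using that len eq[symmetric] by (auto simp: shift_right_iff)
  \<comment> \<open>A bead of \<open>P\<close> whose old place is not filled by another bead of \<open>P\<close> leaves a space that has
    a bead immediately to its right, and \<open>(c, 1)\<close> is the only such space.\<close>
  have stuck: "P ! i = (c, 1)" if i: "i < e" and "(fst (P ! i) - 1, snd (P ! i)) \<notin> set P" for i
  proof -
    obtain x y where xy: "P ! i = (x, y)" by (cases "P ! i")
    have "(x, y) \<in> set P" using i len nth_mem[of i P] by (simp add: xy)
    then have "(x, y) \<notin> shift_right P C"
      using that(2) by (simp add: shift_right_iff xy)
    then have "(x, y) \<notin> gap_abacus l s N c" by (simp add: eq)
    moreover have "(x + 1, y) \<in> gap_abacus l s N c" using right[OF i] by (simp add: xy)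
    ultimately have "x = c \<and> y = 1"
      unfolding gap_abacus_iff by (cases "y = 1") simp_all
    then show ?thesis by (simp add: xy)
  qed
  have col: "fst (P ! i) = fst (P ! 0) - int i" if "i < e" for i
    using quasiperiod_column[OF P that] .
  have mem: "\<exists>k<e. b = P ! k" if "b \<in> set P" for b
    using that len by (auto simp: in_set_conv_nth)
  have last: "P ! (e - 1) = (c, 1)"
  proof (rule stuck)
    show "(fst (P ! (e - 1)) - 1, snd (P ! (e - 1))) \<notin> set P"
    proof
      assume "(fst (P ! (e - 1)) - 1, snd (P ! (e - 1))) \<in> set P"
      then obtain k where k: "k < e" "fst (P ! k) = fst (P ! (e - 1)) - 1"
        using mem by (metis fst_conv)
      then show False using col[of k] col[of "e - 1"] e by simp
    qed
  qed (use e in simp)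
  then have x0: "fst (P ! 0) = c + int e - 1" using col[of "e - 1"] e by simp
  \<comment> \<open>Going back from the last bead: outside row \<open>1\<close> a bead would leave a space as well, because
    the bead of \<open>P\<close> in the next column to the left is in row \<open>1\<close>.\<close>
  have nth: "P ! (e - 1 - m) = (c + int m, 1)" if "m < e" for m
    using that
  proof (induction m)
    case (Suc m)
    let ?i = "e - 1 - Suc m"
    have i: "?i < e" using Suc by simp
    have fi: "fst (P ! ?i) = c + int (Suc m)" using col[OF i] x0 Suc.prems by simp
    have "snd (P ! ?i) = 1"
    proof (rule ccontr)
      assume "snd (P ! ?i) \<noteq> 1"
      have "(fst (P ! ?i) - 1, snd (P ! ?i)) \<in> set P"
        using stuck[OF i] \<open>snd (P ! ?i) \<noteq> 1\<close> by fastforce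
      then obtain k where k: "k < e" "P ! k = (fst (P ! ?i) - 1, snd (P ! ?i))"
        using mem by metis
      then have "int k = int (e - 1 - m)"
        using col[OF k(1)] x0 fi Suc.prems by simp
      then have "k = e - 1 - m" by (simp only: of_nat_eq_iff)
      then have "P ! k = (c + int m, 1)" using Suc by simp
      then show False using k(2) \<open>snd (P ! ?i) \<noteq> 1\<close> by simp
    qed
    then show ?case using fi by (simp add: prod_eq_iff)
  qed (use last in simp)
  show P_eq: "P = row_period e c"
  proof (rule nth_equalityI)
    fix i assume "i < length P"
    then have "i < e" using len by simp
    then show "P ! i = row_period e c ! i"
      using nth[of "e - 1 - i"] by (simp add: row_period_nth)
  qed (simp add: len)
  have setP: "set P = {c..<c + int e} \<times> {1}" by (simp add: P_eq set_row_period)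
  have "(c + int e, 1) \<in> gap_abacus l s N c"
    using right[of 0] nth[of "e - 1"] e by simp
  then show cN: "c + int e \<le> N" by (simp add: gap_abacus_iff)
  have C_iff: "b \<in> C \<longleftrightarrow> b \<in> gap_abacus l s N (c + int e)" if "b \<noteq> (c + int e, 1)" for b
  proof -
    obtain \<beta> j where b: "b = (\<beta>, j)" by (cases b)
    show ?thesis
    proof (cases "b \<in> set P")
      case True
      then have "b \<in> gap_abacus l s N (c + int e)"
        using cN right[OF e] by (auto simp: setP gap_abacus_iff split: if_splits)
      with True PC show ?thesis by blast
    next
      case False
      then have "(\<beta> - 1, j) \<notin> set P" using that by (auto simp: setP b)
      then have "b \<in> C \<longleftrightarrow> b \<in> gap_abacus l s N c"
        using False unfolding eq[symmetric] by (simp add: b shift_right_iff)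
      then show ?thesis using False that e by (auto simp: b setP gap_abacus_iff split: if_splits)
    qed
  qed
  show "C = gap_abacus l s N (c + int e) \<or> C = gap_abacus l s N (N + 1)"
  proof (cases "(c + int e, 1) \<in> C")
    case False
    then have "b \<in> C \<longleftrightarrow> b \<in> gap_abacus l s N (c + int e)" for b
      using C_iff by (cases "b = (c + int e, 1)") (auto simp: gap_abacus_iff)
    then show ?thesis by blast
  next
    case True
    have "1 \<le> l" using right[OF e] by (cases l) (auto simp: gap_abacus_iff)
    have "b \<in> C \<longleftrightarrow> b \<in> gap_abacus l s N (N + 1)" for b
    proof (cases "b = (c + int e, 1)")
      case True
      then show ?thesis using \<open>(c + int e, 1) \<in> C\<close> cN \<open>1 \<le> l\<close> by (simp add: gap_abacus_iff)
    next
      case False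
      then show ?thesis using C_iff[of b] by (cases b) (auto simp: gap_abacus_iff)
    qed
    then show ?thesis by blast
  qed
qed

lemma first_fore_period_full:
  assumes "1 \<le> l" "0 < e" "c + int e \<le> N"
  shows "fore_period e (gap_abacus l s N (N + 1)) 1 \<noteq> row_period e c"
proof
  let ?A = "gap_abacus l s N (N + 1)"
  assume eq: "fore_period e ?A 1 = row_period e c"
  have "quasiperiod e ?A (row_period e (c + 1))"
    by (rule quasiperiod_row_period) (use assms in \<open>auto simp: gap_abacus_iff\<close>)
  then have "(fore_period e ?A 1, row_period e (c + 1)) \<notin> lexord bead_less"
    by (rule fore_period_not_less[OF is_abacus_gap_abacus assms(1,2) order.refl]) simp
  then have "(row_period e c, row_period e (c + 1)) \<notin> lexord bead_less"
    by (simp only: eq not_False_eq_True)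
  moreover have "(row_period e c, row_period e (c + 1)) \<in> lexord bead_less"
    by (rule lexord_of_first[of _ _ e]) (use assms(2) in \<open>auto simp: row_period_nth bead_less_def\<close>)
  ultimately show False by blast
qed

text \<open>Shift the \<open>k\<close>-th fore period one unit to the right.\<close>

abbreviation shift_fore :: "nat \<Rightarrow> nat \<Rightarrow> abacus \<Rightarrow> abacus" where
  "shift_fore e k B \<equiv> shift_right (fore_period e B k) B"

lemma is_abacus_fold_shift_fore:
  assumes "is_abacus l B" "1 \<le> l" "0 < e" "\<forall>k\<in>set ks. 1 \<le> k"
  shows "is_abacus l (fold (shift_fore e) ks B)"
  using assms
proof (induction ks arbitrary: B)
  case (Cons k ks)
  then have "is_abacus l (shift_fore e k B)"
    using is_abacus_shift_right fore_period_quasiperiod by (metis list.set_intros(1))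
  with Cons show ?case by simp
qed simp

text \<open>A sequence of shifts, of the first fore period to begin with, that ends at \<open>G c\<close> has moved
  the gap \<open>e\<close> columns to the left each time. The induction removes the last shift. If that
  shift started from the abacus without gaps, which is \<open>G (N + 1)\<close>, then the induction
  hypothesis leaves no room for an earlier shift, and the only shift would be that of a
  first fore period, which is impossible by \<open>first_fore_period_full\<close>.\<close>

lemma fold_shift_fore_eq_gap_abacus:
  assumes "is_abacus l B" "1 \<le> l" "0 < e" "\<forall>k\<in>set ks. 1 \<le> k" "ks \<noteq> [] \<longrightarrow> hd ks = 1"
    and "fold (shift_fore e) ks B = gap_abacus l s N c"
  shows "B = gap_abacus l s N (c + int e * int (length ks)) \<and>
    (ks \<noteq> [] \<longrightarrow> c + int e * int (length ks) \<le> N) \<and>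
    (\<forall>i<length ks.
       fold (shift_fore e) (take i ks) B = gap_abacus l s N (c + int e * int (length ks - i)) \<and>
       fore_period e (fold (shift_fore e) (take i ks) B) (ks ! i) =
         row_period e (c + int e * int (length ks - Suc i)))"
  using assms(4-6)
proof (induction ks arbitrary: c rule: rev_induct)
  case (snoc k ks)
  define C where "C = fold (shift_fore e) ks B"
  have C: "is_abacus l C" unfolding C_def
    by (rule is_abacus_fold_shift_fore[OF assms(1-3)]) (use snoc.prems in auto)
  have k: "1 \<le> k" using snoc.prems by simp
  have eq: "shift_right (fore_period e C k) C = gap_abacus l s N c"
    using snoc.prems by (simp add: C_def)
  note * = shift_right_eq_gap_abacus[OF fore_period_quasiperiod[OF C assms(2,3) k] assms(3) eq]
  have pre: "\<forall>k\<in>set ks. 1 \<le> k" "ks \<noteq> [] \<longrightarrow> hd ks = 1"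
    using snoc.prems by auto
  have ne: "C \<noteq> gap_abacus l s N (N + 1)"
  proof
    assume full: "C = gap_abacus l s N (N + 1)"
    show False
    proof (cases "ks = []")
      case True
      then have "k = 1" using snoc.prems by simp
      then show False using first_fore_period_full[OF assms(2,3) *(2)] *(1) full by simp
    next
      case False
      have "N + 1 + int e * int (length ks) \<le> N"
        using snoc.IH[OF pre full[unfolded C_def]] False by simp
      moreover have "0 \<le> int e * int (length ks)" by simp
      ultimately show False by linarith
    qed
  qed
  then have Ceq: "C = gap_abacus l s N (c + int e)" using *(3) by blast
  note IH = snoc.IH[OF pre Ceq[unfolded C_def]]
  have arith: "c + int e + int e * int m = c + int e * int (Suc m)" for m
    by (simp add: algebra_simps)
  show ?case
  proof (intro conjI allI impI)
    show "B = gap_abacus l s N (c + int e * int (length (ks @ [k])))"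
      using IH by (simp add: algebra_simps)
    show "c + int e * int (length (ks @ [k])) \<le> N"
    proof (cases "ks = []")
      case False
      then show ?thesis using IH by (simp add: algebra_simps)
    qed (use *(2) in simp)
    fix i assume i: "i < length (ks @ [k])"
    show "fold (shift_fore e) (take i (ks @ [k])) B
        = gap_abacus l s N (c + int e * int (length (ks @ [k]) - i))"
    proof (cases "i = length ks")
      case True
      then show ?thesis using Ceq by (simp add: C_def)
    next
      case False
      then have "i < length ks" using i by simp
      then have "fold (shift_fore e) (take i ks) B
          = gap_abacus l s N (c + int e * int (Suc (length ks - i)))"
        using IH \<open>i < length ks\<close> unfolding arith by blast
      then show ?thesis using \<open>i < length ks\<close> by (simp add: Suc_diff_le)
    qed
    show "fore_period e (fold (shift_fore e) (take i (ks @ [k])) B) ((ks @ [k]) ! i) =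
         row_period e (c + int e * int (length (ks @ [k]) - Suc i))"
    proof (cases "i = length ks")
      case True
      then show ?thesis using *(1) by (simp add: C_def)
    next
      case False
      then have "i < length ks" using i by simp
      then have "fore_period e (fold (shift_fore e) (take i ks) B) (ks ! i) =
          row_period e (c + int e * int (Suc (length ks - Suc i)))"
        using IH \<open>i < length ks\<close> unfolding arith by blast
      moreover have "Suc (length ks - Suc i) = length (ks @ [k]) - Suc i"
        using \<open>i < length ks\<close> by simp
      ultimately show ?thesis using \<open>i < length ks\<close> by (simp add: nth_append del: of_nat_Suc)
    qed
  qed
qed simp


section \<open>The word of fore period indices of a partition\<close>

text \<open>The indices of the fore periods that are shifted in turn by \<open>b_tilde e \<sigma>\<close>: \<open>k\<close> occurs as
  often as the \<open>k\<close>-th part of \<open>\<sigma>\<close> says.\<close>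

definition shift_word :: "nat list \<Rightarrow> nat list" where
  "shift_word \<sigma> = concat (map (\<lambda>k. replicate (part \<sigma> k) k) [1..<Suc (length \<sigma>)])"

lemma fold_concat_replicate:
  "fold (\<lambda>k. f k ^^ p k) ks A = fold f (concat (map (\<lambda>k. replicate (p k) k) ks)) A"
proof (induction ks arbitrary: A)
  case (Cons k ks)
  have "fold f (replicate m k) A = (f k ^^ m) A" for m A
    by (induction m arbitrary: A) (simp_all add: funpow_swap1)
  with Cons show ?case by simp
qed simp

lemma b_tilde_eq_fold: "b_tilde e \<sigma> A = fold (shift_fore e) (shift_word \<sigma>) A"
  unfolding b_tilde_def shift_word_def by (rule fold_concat_replicate)

lemma length_shift_word: "length (shift_word \<sigma>) = sum_list \<sigma>"
proof -
  have "map (part \<sigma>) [1..<Suc (length \<sigma>)] = \<sigma>"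
    by (rule nth_equalityI) (simp_all add: part_def del: upt_Suc)
  then show ?thesis
    by (simp add: shift_word_def length_concat comp_def del: upt_Suc)
qed

lemma shift_word_ge_1: "k \<in> set (shift_word \<sigma>) \<Longrightarrow> 1 \<le> k"
  by (auto simp: shift_word_def simp del: upt_Suc)

text \<open>If every index occurs, then the entries grow by at most one from each place to the next.\<close>

lemma nth_concat_replicate_le:
  assumes "\<And>k. k \<in> set [a..<b] \<Longrightarrow> 0 < p k"
    and "i < length (concat (map (\<lambda>k. replicate (p k) k) [a..<b]))"
  shows "concat (map (\<lambda>k. replicate (p k) k) [a..<b]) ! i \<le> a + i"
  using assms
proof (induction "b - a" arbitrary: a i)
  case (Suc n)
  then have ab: "a < b" by simp
  let ?c = "\<lambda>a. concat (map (\<lambda>k. replicate (p k) k) [a..<b])"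
  have eq: "?c a = replicate (p a) a @ ?c (Suc a)"
    using ab by (simp add: upt_conv_Cons)
  show ?case
  proof (cases "i < p a")
    case True
    then show ?thesis by (simp add: eq nth_append)
  next
    case False
    have pos: "0 < p a" using Suc.prems(1)[of a] ab by simp
    have "?c (Suc a) ! (i - p a) \<le> Suc a + (i - p a)"
      by (rule Suc.hyps(1)) (use Suc.prems Suc.hyps(2) eq False in auto)
    then show ?thesis using False pos by (simp add: eq nth_append)
  qed
qed simp

lemma shift_word_nth_le:
  assumes "is_partition \<sigma>" "i < length (shift_word \<sigma>)"
  shows "shift_word \<sigma> ! i \<le> Suc i"
proof -
  have "0 < part \<sigma> k" if "k \<in> set [1..<Suc (length \<sigma>)]" for k
    using that assms(1) by (auto simp: part_def is_partition_def simp del: upt_Suc)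
  then show ?thesis
    using nth_concat_replicate_le[of 1 "Suc (length \<sigma>)" "part \<sigma>" i] assms(2)
    unfolding shift_word_def by (simp del: upt_Suc)
qed

lemma hd_shift_word:
  assumes "is_partition \<sigma>" "shift_word \<sigma> \<noteq> []"
  shows "hd (shift_word \<sigma>) = 1"
proof -
  have "shift_word \<sigma> ! 0 \<le> Suc 0" using shift_word_nth_le[OF assms(1), of 0] assms(2) by simp
  moreover have "1 \<le> shift_word \<sigma> ! 0" using assms(2) by (intro shift_word_ge_1[of _ \<sigma>] nth_mem) simp
  ultimately show ?thesis using assms(2) by (simp add: hd_conv_nth)
qed

lemma is_partition_sum_list_pos: "is_partition \<sigma> \<Longrightarrow> \<sigma> \<noteq> [] \<Longrightarrow> 0 < sum_list \<sigma>"
  by (cases \<sigma>) (auto simp: is_partition_def)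

lemma b_tilde_eq_gap_abacus:
  assumes "is_partition \<sigma>" "is_abacus l B" "1 \<le> l" "0 < e" "b_tilde e \<sigma> B = gap_abacus l s N c"
  shows "B = gap_abacus l s N (c + int e * int (sum_list \<sigma>))"
    and "\<sigma> \<noteq> [] \<Longrightarrow> c + int e * int (sum_list \<sigma>) \<le> N"
    and "\<And>i. i < sum_list \<sigma> \<Longrightarrow> \<exists>k. 1 \<le> k \<and> k \<le> Suc i \<and>
      fore_period e (gap_abacus l s N (c + int e * int (sum_list \<sigma> - i))) k =
        row_period e (c + int e * int (sum_list \<sigma> - Suc i))"
proof -
  have 0: "\<forall>k\<in>set (shift_word \<sigma>). 1 \<le> k" using shift_word_ge_1 by blast
  note * = fold_shift_fore_eq_gap_abacus[OF assms(2-4) 0 impI[OF hd_shift_word[OF assms(1)]]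
      assms(5)[unfolded b_tilde_eq_fold], unfolded length_shift_word]
  show "B = gap_abacus l s N (c + int e * int (sum_list \<sigma>))" using * by blast
  show "c + int e * int (sum_list \<sigma>) \<le> N" if "\<sigma> \<noteq> []"
    using * is_partition_sum_list_pos[OF assms(1) that]
    by (metis length_0_conv length_shift_word less_irrefl)
  show "\<exists>k. 1 \<le> k \<and> k \<le> Suc i \<and>
      fore_period e (gap_abacus l s N (c + int e * int (sum_list \<sigma> - i))) k =
        row_period e (c + int e * int (sum_list \<sigma> - Suc i))" if "i < sum_list \<sigma>" for i
  proof (intro exI[of _ "shift_word \<sigma> ! i"] conjI)
    show "1 \<le> shift_word \<sigma> ! i"
      using that by (intro shift_word_ge_1[of _ \<sigma>] nth_mem) (simp add: length_shift_word)
    show "shift_word \<sigma> ! i \<le> Suc i"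
      using shift_word_nth_le[OF assms(1)] that by (simp add: length_shift_word)
    have a: "fold (shift_fore e) (take i (shift_word \<sigma>)) B
        = gap_abacus l s N (c + int e * int (sum_list \<sigma> - i))"
      using * that by blast
    show "fore_period e (gap_abacus l s N (c + int e * int (sum_list \<sigma> - i))) (shift_word \<sigma> ! i) =
        row_period e (c + int e * int (sum_list \<sigma> - Suc i))"
      unfolding a[symmetric] using * that by blast
  qed
qed

section \<open>Fore periods of abaci with a single gap\<close>

text \<open>Cut the columns up to \<open>N\<close> into blocks of length \<open>e\<close>, numbered from the right starting
  with \<open>1\<close>. A column close enough to \<open>N\<close> lies in one of the first \<open>m\<close> blocks.\<close>

lemma obtain_block:
  fixes x N :: int
  assumes "0 < e" "x \<le> N" "N < x + int e * int m"
  obtains i where "1 \<le> i" "i \<le> m"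
    "x \<in> {N + 1 - int e * int i..<N + 1 - int e * int i + int e}"
proof
  define i where "i = Suc (nat ((N - x) div int e))"
  have ei: "int e * int i = int e * ((N - x) div int e) + int e"
    using assms(1,2) by (simp add: i_def pos_imp_zdiv_nonneg_iff algebra_simps)
  have bounds: "int e * ((N - x) div int e) \<le> N - x"
    "N - x < int e * ((N - x) div int e) + int e"
    using assms(1) pos_mod_bound[of "int e" "N - x"] pos_mod_sign[of "int e" "N - x"]
      mult_div_mod_eq[of "int e" "N - x"] by linarith+
  show "1 \<le> i" by (simp add: i_def)
  have "int e * int i < int e * (int m + 1)"
    using ei bounds assms(3) unfolding distrib_left by linarith
  then show "i \<le> m" using assms(1) by (simp add: mult_less_cancel_left)
  show "x \<in> {N + 1 - int e * int i..<N + 1 - int e * int i + int e}"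
    unfolding atLeastLessThan_iff using ei bounds by linarith
qed

text \<open>As long as no other row reaches column \<open>c + e\<close>, the first fore periods are the blocks of
  row \<open>1\<close> counted from column \<open>N\<close> downwards that fit to the right of the gap.\<close>

lemma fore_period_right_of_gap:
  assumes "1 \<le> l" "0 < e" "\<And>j. j \<in> {2..l} \<Longrightarrow> s j < c + int e"
    and "c + int e * int k \<le> N" "1 \<le> k"
  shows "fore_period e (gap_abacus l s N c) k = row_period e (N + 1 - int e * int k)"
  using assms(4,5)
proof (induction k rule: less_induct)
  case (less k)
  let ?A = "gap_abacus l s N c"
  have earlier: "set (fore_period e ?A i) = {N + 1 - int e * int i..<N + 1 - int e * int i + int e} \<times> {1}"
    if "1 \<le> i" "i < k" for i
  proof -
    have "int e * int i \<le> int e * int k" using that by (intro mult_left_mono) auto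
    then have "fore_period e ?A i = row_period e (N + 1 - int e * int i)"
      using less.prems that by (intro less.IH) auto
    then show ?thesis by (simp add: set_row_period)
  qed
  have ek: "int e \<le> int e * int k"
    using mult_left_mono[of 1 "int k" "int e"] less.prems(2) by simp
  show ?case
  proof (rule fore_period_eqI[OF is_abacus_gap_abacus assms(1,2) less.prems(2)])
    show "quasiperiod e ?A (row_period e (N + 1 - int e * int k))"
    proof (rule quasiperiod_row_period, rule subsetI)
      fix z :: bead
      assume "z \<in> {N + 1 - int e * int k..<N + 1 - int e * int k + int e} \<times> {1}"
      then obtain x where z: "z = (x, 1)"
        and x: "N + 1 - int e * int k \<le> x" "x < N + 1 - int e * int k + int e"
        by (cases z) (simp only: mem_Times_iff fst_conv snd_conv atLeastLessThan_iff singleton_iff)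
      have "c < x" "x \<le> N" using x ek less.prems(1) by linarith+
      then show "z \<in> ?A" using assms(1) by (simp add: z gap_abacus_iff)
    qed
    show "set (row_period e (N + 1 - int e * int k)) \<inter> set (fore_period e ?A i) = {}"
      if "1 \<le> i" "i < k" for i
    proof -
      have "int e * int (Suc i) \<le> int e * int k" using that by (intro mult_left_mono) auto
      then have "N + 1 - int e * int k + int e \<le> N + 1 - int e * int i"
        by (simp add: algebra_simps)
      then show ?thesis by (auto simp: earlier[OF that] set_row_period)
    qed
    fix Q assume Q: "quasiperiod e ?A Q"
      and disj: "\<And>i. 1 \<le> i \<Longrightarrow> i < k \<Longrightarrow> set Q \<inter> set (fore_period e ?A i) = {}"
      and ne: "Q \<noteq> row_period e (N + 1 - int e * int k)"
    have mem: "Q ! 0 \<in> set Q" "Q ! 0 \<in> ?A"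
      using Q assms(2) quasiperiod_nth_mem by (auto simp: quasiperiod_def)
    obtain x y where xy: "Q ! 0 = (x, y)" by (cases "Q ! 0")
    have "x \<le> N + 1 - int e * int k + int e - 1"
    proof (rule ccontr)
      assume x: "\<not> x \<le> N + 1 - int e * int k + int e - 1"
      have "y = 1"
        using mem(2) x less.prems(1) assms(3)[of y] by (cases "y = 1") (auto simp: xy gap_abacus_iff)
      then have "x \<le> N" using mem(2) by (simp add: xy gap_abacus_iff)
      have "N < x + int e * int (k - 1)"
        using x less.prems(2) by (simp add: of_nat_diff algebra_simps)
      from obtain_block[OF assms(2) \<open>x \<le> N\<close> this] obtain i where i: "1 \<le> i" "i \<le> k - 1"
        and "x \<in> {N + 1 - int e * int i..<N + 1 - int e * int i + int e}" .
      moreover from i have "i < k" using less.prems(2) by simp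
      ultimately have "(x, y) \<in> set (fore_period e ?A i)"
        unfolding earlier[OF i(1) \<open>i < k\<close>] \<open>y = 1\<close> by blast
      then show False using disj[OF i(1) \<open>i < k\<close>] mem(1) xy by auto
    qed
    then show "(Q, row_period e (N + 1 - int e * int k)) \<in> lexord bead_less"
      by (intro quasiperiod_less_row_period[OF Q gap_abacus_rows assms(2) _ ne]) (simp add: xy)
  qed
qed

text \<open>The first \<open>k - 1\<close> fore periods are to the right of the gap by the previous lemma and
  leave fewer than \<open>e\<close> beads there, too few for another quasiperiod. As no other row reaches the
  gap, the next one starts just left of it.\<close>

lemma fore_period_left_of_gap:
  assumes "1 \<le> l" "0 < e" "\<And>j. j \<in> {2..l} \<Longrightarrow> s j < c"
    and "1 \<le> k" "c + int e * (int k - 1) \<le> N" "N < c + int e * int k"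
  shows "fore_period e (gap_abacus l s N c) k = row_period e (c - int e)"
proof (rule fore_period_eqI[OF is_abacus_gap_abacus assms(1,2,4)])
  let ?A = "gap_abacus l s N c"
  have earlier: "set (fore_period e ?A i) = {N + 1 - int e * int i..<N + 1 - int e * int i + int e} \<times> {1}
      \<and> c < N + 1 - int e * int i"
    if "1 \<le> i" "i < k" for i
  proof -
    have "int e * int i \<le> int e * (int k - 1)" using that by (intro mult_left_mono) auto
    then have cN: "c + int e * int i \<le> N" using assms(5) by linarith
    have "s j < c + int e" if "j \<in> {2..l}" for j using assms(3)[OF that] by simp
    from fore_period_right_of_gap[OF assms(1,2) this cN that(1)]
    show ?thesis using cN by (simp add: set_row_period)
  qed
  have ek: "int e * int k = int e * (int k - 1) + int e" by (simp add: algebra_simps)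
  have cN: "c \<le> N" using assms(2,4,5)
    by (smt (verit) mult_nonneg_nonneg of_nat_0_le_iff of_nat_1 of_nat_mono)
  show "quasiperiod e ?A (row_period e (c - int e))"
    by (rule quasiperiod_row_period) (use assms(1) cN in \<open>auto simp: gap_abacus_iff\<close>)
  show "set (row_period e (c - int e)) \<inter> set (fore_period e ?A i) = {}"
    if "1 \<le> i" "i < k" for i
  proof (rule Int_emptyI)
    fix z assume "z \<in> set (row_period e (c - int e))" and "z \<in> set (fore_period e ?A i)"
    then have "fst z < c" and "N + 1 - int e * int i \<le> fst z"
      using earlier[OF that] by (simp_all add: set_row_period mem_Times_iff)
    then show False using earlier[OF that] by linarith
  qed
  fix Q assume Q: "quasiperiod e ?A Q"
    and disj: "\<And>i. 1 \<le> i \<Longrightarrow> i < k \<Longrightarrow> set Q \<inter> set (fore_period e ?A i) = {}"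
    and ne: "Q \<noteq> row_period e (c - int e)"
  have mem: "Q ! 0 \<in> set Q" "Q ! 0 \<in> ?A"
    using Q assms(2) quasiperiod_nth_mem by (auto simp: quasiperiod_def)
  obtain x y where xy: "Q ! 0 = (x, y)" by (cases "Q ! 0")
  have "x < c"
  proof (rule ccontr)
    assume x: "\<not> x < c"
    have y: "y = 1"
      using mem(2) x assms(3)[of y] by (cases "y = 1") (auto simp: xy gap_abacus_iff)
    then have xN: "x \<le> N" and xc: "c < x" using mem(2) x by (auto simp: xy gap_abacus_iff)
    have Q_eq: "Q = row_period e (x - int e + 1)"
      by (rule quasiperiod_eq_row_period[OF Q gap_abacus_rows assms(2)]) (simp add: xy y)
    have "(c, 1) \<notin> set Q" using Q by (auto simp: quasiperiod_def gap_abacus_iff)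
    then have x1: "c + int e \<le> x" using xc by (auto simp: Q_eq set_row_period)
    have "N < x + int e * int (k - 1)"
      using x1 assms(4,6) by (simp add: of_nat_diff algebra_simps)
    from obtain_block[OF assms(2) xN this] obtain i where i: "1 \<le> i" "i \<le> k - 1"
      and "x \<in> {N + 1 - int e * int i..<N + 1 - int e * int i + int e}" .
    moreover from i have "i < k" using assms(4) by simp
    ultimately have "(x, y) \<in> set (fore_period e ?A i)"
      unfolding conjunct1[OF earlier[OF i(1) \<open>i < k\<close>]] y by blast
    then show False using disj[OF i(1) \<open>i < k\<close>] mem(1) xy by auto
  qed
  then show "(Q, row_period e (c - int e)) \<in> lexord bead_less"
    by (intro quasiperiod_less_row_period[OF Q gap_abacus_rows assms(2) _ ne]) (simp add: xy)
qed


section \<open>Depth in the crystal of type \<open>sl_infinity\<close>\<close>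

lemma shift_word_column: "shift_word (replicate m 1) = [1..<Suc m]"
proof -
  have "map (\<lambda>k. replicate (part (replicate m 1) k) k) [1..<Suc m] = map (\<lambda>k. [k]) [1..<Suc m]"
    by (rule map_cong) (auto simp: part_def simp del: upt_Suc)
  then show ?thesis
    unfolding shift_word_def length_replicate by (simp only: concat_map_singleton map_ident)
qed

lemma is_partition_column: "is_partition (replicate m 1)"
  by (auto simp: is_partition_def sorted_wrt_iff_nth_less)

lemma b_tilde_column_gap_abacus:
  assumes "1 \<le> l" "r < e" "\<And>j. j \<in> {2..l} \<Longrightarrow> s j < 0"
    and N: "N = int e * (int q - 1) + int r" and "m \<le> q"
  shows "b_tilde e (replicate m 1) (gap_abacus l s N (int e * (int q - 1))) =
    gap_abacus l s N (int e * (int q - 1 - int m))"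
  unfolding b_tilde_eq_fold shift_word_column
  using assms(5)
proof (induction m)
  case (Suc m)
  define c where "c = int e * (int q - 1 - int m)"
  have "0 \<le> c" using Suc.prems by (auto simp: c_def)
  have c1: "c + int e * (int (Suc m) - 1) = int e * (int q - 1)"
    and c2: "c + int e * int (Suc m) = int e * (int q - 1) + int e"
    and c3: "c - int e = int e * (int q - 1 - int (Suc m))"
    by (simp_all add: c_def algebra_simps)
  have "0 \<le> int e * int m" by simp
  moreover have "c + int e * int m = int e * (int q - 1)" using c1 by simp
  ultimately have "c \<le> int e * (int q - 1)" by linarith
  then have "c \<le> N" by (simp add: N)
  have "fore_period e (gap_abacus l s N c) (Suc m) = row_period e (c - int e)"
  proof (rule fore_period_left_of_gap)
    show "s j < c" if "j \<in> {2..l}" for j using assms(3)[OF that] \<open>0 \<le> c\<close> by simp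
    show "c + int e * (int (Suc m) - 1) \<le> N" unfolding c1 N by simp
    show "N < c + int e * int (Suc m)" unfolding c2 N using assms(2) by simp
  qed (use assms in auto)
  then show ?case
    using Suc shift_right_row_period[OF \<open>c \<le> N\<close> assms(1), of e s] assms(2)
    by (simp add: c_def[symmetric] c3)
qed simp

text \<open>The highest weight vertex is \<open>G ((q - 1) * e)\<close>. Any \<open>B\<close> with \<open>G (-e) = b_tilde e \<theta> B\<close> is
  \<open>G ((d - 1) * e)\<close> with \<open>d = \<bar>\<theta>\<bar> \<le> q\<close>, and for \<open>d < q\<close> a column of length \<open>q - d\<close> leads to it,
  so it does not have highest weight.\<close>

lemma sl_inf_depth_no_bead_right_of_origin:
  assumes l: "1 \<le> l" and r: "r < e" and neg: "\<And>j. j \<in> {2..l} \<Longrightarrow> s j < 0"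
    and N: "N = int e * (int q - 1) + int r"
  shows "sl_inf_depth e l (gap_abacus l s N (- int e)) = q"
proof -
  let ?G = "gap_abacus l s N"
  have e: "0 < e" using r by simp
  have col: "b_tilde e (replicate m 1) (?G (int e * (int q - 1))) = ?G (int e * (int q - 1 - int m))"
    if "m \<le> q" for m
    using b_tilde_column_gap_abacus[where s = s, OF l r neg N that] .
  have hw: "sl_inf_highest_weight e l (?G (int e * (int q - 1)))"
    unfolding sl_inf_highest_weight_def
  proof (intro conjI notI is_abacus_gap_abacus)
    assume "\<exists>\<sigma> B. is_partition \<sigma> \<and> \<sigma> \<noteq> [] \<and> is_abacus l B \<and> ?G (int e * (int q - 1)) = b_tilde e \<sigma> B"
    then obtain \<sigma> B where \<sigma>: "is_partition \<sigma>" "\<sigma> \<noteq> []" and B: "is_abacus l B"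
      and eq: "b_tilde e \<sigma> B = ?G (int e * (int q - 1))" by metis
    have "int e * (int q - 1) + int e * int (sum_list \<sigma>) \<le> N"
      using b_tilde_eq_gap_abacus(2)[OF \<sigma>(1) B l e eq \<sigma>(2)] .
    moreover have "int e * 1 \<le> int e * int (sum_list \<sigma>)"
      using is_partition_sum_list_pos[OF \<sigma>] by (intro mult_left_mono) auto
    ultimately show False using r by (simp add: N)
  qed
  show ?thesis
    unfolding sl_inf_depth_def
  proof (rule the_equality)
    have "b_tilde e (replicate q 1) (?G (int e * (int q - 1))) = ?G (- int e)"
      using col[of q] by simp
    then show "\<exists>\<theta> B. is_partition \<theta> \<and> sl_inf_highest_weight e l B \<and>
        ?G (- int e) = b_tilde e \<theta> B \<and> q = sum_list \<theta>"
      using hw is_partition_column[of q]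
      by (intro exI[of _ "replicate q 1"] exI[of _ "?G (int e * (int q - 1))"])
        (simp add: sum_list_replicate)
  next
    fix d assume "\<exists>\<theta> B. is_partition \<theta> \<and> sl_inf_highest_weight e l B \<and>
        ?G (- int e) = b_tilde e \<theta> B \<and> d = sum_list \<theta>"
    then obtain \<theta> B where \<theta>: "is_partition \<theta>" and B: "sl_inf_highest_weight e l B"
      and eq: "b_tilde e \<theta> B = ?G (- int e)" and d: "d = sum_list \<theta>" by metis
    have ab: "is_abacus l B" using B by (simp add: sl_inf_highest_weight_def)
    note * = b_tilde_eq_gap_abacus[OF \<theta> ab l e eq, folded d]
    have "d \<le> q"
    proof (cases "\<theta> = []")
      case False
      then have "- int e + int e * int d \<le> N" using *(2) by simp
      then have "int e * int d < int e * (int q + 1)" using r by (simp add: N algebra_simps)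
      then show ?thesis using e by (simp add: mult_less_cancel_left)
    qed (simp add: d)
    moreover have "\<not> d < q"
    proof
      assume "d < q"
      have "int q - 1 - int (q - d) = int d - 1" using \<open>d < q\<close> by simp
      then have "b_tilde e (replicate (q - d) 1) (?G (int e * (int q - 1))) = ?G (int e * (int d - 1))"
        using col[of "q - d"] by simp
      also have "\<dots> = B" using *(1) by (simp add: algebra_simps)
      finally show False
        using B \<open>d < q\<close> is_abacus_gap_abacus is_partition_column[of "q - d"]
        unfolding sl_inf_highest_weight_def by (metis length_greater_0_conv length_replicate zero_less_diff)
    qed
    ultimately show "d = q" by simp
  qed
qed

lemma quasiperiod_jump:
  assumes "0 < e" "(c, j) \<in> A" "{c + 1 - int e..<c} \<times> {1} \<subseteq> A" "1 \<le> j"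
  shows "quasiperiod e A ((c, j) # row_period (e - 1) (c + 1 - int e))"
  unfolding quasiperiod_def
proof (intro conjI allI impI)
  have "c + 1 - int e + int (e - 1) = c" using assms(1) by simp
  then show "set ((c, j) # row_period (e - 1) (c + 1 - int e)) \<subseteq> A"
    using assms(2,3) by (simp add: set_row_period)
  fix i assume i: "Suc i < e"
  show "fst (((c, j) # row_period (e - 1) (c + 1 - int e)) ! Suc i) =
      fst (((c, j) # row_period (e - 1) (c + 1 - int e)) ! i) - 1"
    using i by (cases i) (auto simp: row_period_nth)
  show "snd (((c, j) # row_period (e - 1) (c + 1 - int e)) ! Suc i)
      \<le> snd (((c, j) # row_period (e - 1) (c + 1 - int e)) ! i)"
    using i assms(4) by (cases i) (auto simp: row_period_nth)
qed (use assms(1) in simp)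

text \<open>Suppose that \<open>T > 0\<close> shifts lead to \<open>G (-e)\<close>. Let \<open>s j\<close> be maximal and \<open>g\<close> the integer part
  of \<open>s j / e\<close>. After \<open>i\<close> shifts the gap is at \<open>h * e\<close>, where \<open>h = T - 1 - i\<close>. The stage \<open>i\<close> is
  chosen such that \<open>h = g\<close>, or \<open>i = 0\<close> if already \<open>T - 1 \<le> g\<close>. At most \<open>i\<close> fore periods precede
  the one that is shifted next, and these fit into row \<open>1\<close> to the right of the gap.\<close>

lemma sl_inf_highest_weight_bead_right_of_origin:
  assumes l: "1 \<le> l" and e: "0 < e" and pos: "\<exists>j\<in>{2..l}. 0 \<le> s j"
  shows "sl_inf_highest_weight e l (gap_abacus l s N (- int e))"
  unfolding sl_inf_highest_weight_def
proof (intro conjI notI is_abacus_gap_abacus)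
  let ?G = "gap_abacus l s N"
  assume "\<exists>\<sigma> B. is_partition \<sigma> \<and> \<sigma> \<noteq> [] \<and> is_abacus l B \<and> ?G (- int e) = b_tilde e \<sigma> B"
  then obtain \<sigma> B where \<sigma>: "is_partition \<sigma>" "\<sigma> \<noteq> []" and B: "is_abacus l B"
    and eq: "b_tilde e \<sigma> B = ?G (- int e)" by metis
  define T where "T = sum_list \<sigma>"
  note * = b_tilde_eq_gap_abacus[OF \<sigma>(1) B l e eq, folded T_def]
  have T: "0 < T" using is_partition_sum_list_pos[OF \<sigma>] by (simp add: T_def)
  have TN: "- int e + int e * int T \<le> N" using *(2)[OF \<sigma>(2)] .
  have "Max (s ` {2..l}) \<in> s ` {2..l}" using pos by (intro Max_in) auto
  then obtain j where j: "j \<in> {2..l}" and "s j = Max (s ` {2..l})" by auto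
  then have max: "s j' \<le> s j" if "j' \<in> {2..l}" for j' using that by simp
  have sj: "0 \<le> s j" using pos max by fastforce
  define g where "g = nat (s j div int e)"
  have "int g = s j div int e" using sj e by (simp add: g_def pos_imp_zdiv_nonneg_iff)
  then have "s j = int e * int g + s j mod int e" by simp
  moreover have "0 \<le> s j mod int e" "s j mod int e < int e" using e by simp_all
  ultimately have g: "int e * int g \<le> s j" "s j < int e * int g + int e" by linarith+
  \<comment> \<open>Subtraction of natural numbers: \<open>i = 0\<close> and \<open>h = T - 1\<close> if \<open>T - 1 \<le> g\<close>.\<close>
  define i where "i = T - 1 - g"
  define h where "h = T - 1 - i"
  define c where "c = int e * int h"
  have iT: "i < T" and hg: "h \<le> g" and h_eq: "i \<noteq> 0 \<Longrightarrow> h = g"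
    using T by (auto simp: i_def h_def)
  have c1: "- int e + int e * int (T - i) = c" and c2: "- int e + int e * int (T - Suc i) = c - int e"
  proof -
    have "T - i = Suc h" "T - Suc i = h" using iT by (auto simp: h_def)
    then show "- int e + int e * int (T - i) = c" "- int e + int e * int (T - Suc i) = c - int e"
      by (simp_all add: c_def algebra_simps)
  qed
  obtain k where k: "1 \<le> k" "k \<le> Suc i" and fore: "fore_period e (?G c) k = row_period e (c - int e)"
    using *(3)[OF iT] unfolding c1 c2 by blast
  have "int e * int h \<le> int e * int g" using hg by (intro mult_left_mono) auto
  then have csj: "c \<le> s j" using g(1) by (simp add: c_def)
  have ci: "c + int e * int i = - int e + int e * int T"
  proof -
    have "int h = int T - 1 - int i" using iT by (simp add: h_def)
    then show ?thesis unfolding c_def by (simp only:) (simp add: algebra_simps)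
  qed
  then have ciN: "c + int e * int i \<le> N" using TN by simp
  have "0 \<le> int e * int i" by simp
  then have cN: "c \<le> N" using ciN by linarith
  let ?Q = "(c, j) # row_period (e - 1) (c + 1 - int e)"
  have Q: "quasiperiod e (?G c) ?Q"
    by (rule quasiperiod_jump) (use e j csj cN l in \<open>auto simp: gap_abacus_iff\<close>)
  have "(fore_period e (?G c) k, ?Q) \<notin> lexord bead_less"
  proof (rule fore_period_not_less[OF is_abacus_gap_abacus l e k(1) Q])
    fix m assume m: "1 \<le> m" "m < k"
    then have "i \<noteq> 0" using k by simp
    then have "s j' < c + int e" if "j' \<in> {2..l}" for j'
      using max[OF that] g(2) h_eq by (simp add: c_def)
    moreover have "int e * int m \<le> int e * int i" using m k by (intro mult_left_mono) auto
    then have cm: "c + int e * int m \<le> N" using ciN by linarith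
    ultimately have eq: "fore_period e (?G c) m = row_period e (N + 1 - int e * int m)"
      by (intro fore_period_right_of_gap[OF l e _ cm m(1)])
    show "set ?Q \<inter> set (fore_period e (?G c) m) = {}"
    proof (rule Int_emptyI)
      fix z assume z: "z \<in> set ?Q" "z \<in> set (fore_period e (?G c) m)"
      have "fst z \<le> c" using z(1) e by (auto simp: set_row_period)
      moreover have "N + 1 - int e * int m \<le> fst z"
        using z(2) by (simp add: eq set_row_period mem_Times_iff)
      ultimately show False using cm by linarith
    qed
  qed
  moreover have "(fore_period e (?G c) k, ?Q) \<in> lexord bead_less"
    unfolding fore
    by (rule lexord_of_first[of _ _ e]) (use e in \<open>auto simp: row_period_nth bead_less_def\<close>)
  ultimately show False by blast
qed

lemma sl_inf_depth_highest_weight: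
  assumes "sl_inf_highest_weight e l A"
  shows "sl_inf_depth e l A = 0"
  unfolding sl_inf_depth_def
proof (rule the_equality)
  show "\<exists>\<theta> B. is_partition \<theta> \<and> sl_inf_highest_weight e l B \<and> A = b_tilde e \<theta> B \<and> 0 = sum_list \<theta>"
    using assms by (intro exI[of _ "[]"] exI[of _ A]) (simp add: is_partition_def b_tilde_def)
  fix d assume "\<exists>\<theta> B. is_partition \<theta> \<and> sl_inf_highest_weight e l B \<and> A = b_tilde e \<theta> B \<and> d = sum_list \<theta>"
  then show "d = 0" using assms unfolding sl_inf_highest_weight_def by (metis sum_list.Nil)
qed


section \<open>Signatures\<close>

text \<open>A finite set on which \<open>R\<close> is a strict total order has exactly one sorted enumeration.\<close>

lemma ex1_sorted_wrt:
  assumes "finite S" and irrefl: "\<And>x. \<not> R x x"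
    and trans: "\<And>x y z. R x y \<Longrightarrow> R y z \<Longrightarrow> R x z"
    and total: "\<And>x y. x \<in> S \<Longrightarrow> y \<in> S \<Longrightarrow> x \<noteq> y \<Longrightarrow> R x y \<or> R y x"
  shows "\<exists>!w. sorted_wrt R w \<and> set w = S"
proof (rule ex_ex1I)
  show "\<exists>w. sorted_wrt R w \<and> set w = S"
    using assms(1) total
  proof (induction rule: finite_induct)
    case (insert x F)
    then obtain w where w: "sorted_wrt R w" "set w = F" by auto
    define w' where "w' = filter (\<lambda>y. R y x) w @ [x] @ filter (\<lambda>y. R x y) w"
    have "sorted_wrt R w'"
      using w(1) trans by (auto simp: w'_def sorted_wrt_append sorted_wrt_filter)
    moreover have "set w' = insert x F"
      using w(2) insert.prems insert.hyps by (auto simp: w'_def)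
    ultimately show ?case by blast
  qed simp
next
  fix w w' assume "sorted_wrt R w \<and> set w = S" "sorted_wrt R w' \<and> set w' = S"
  then have "sorted_wrt R w" "sorted_wrt R w'" "set w = set w'" by auto
  then show "w = w'"
  proof (induction w arbitrary: w')
    case (Cons x xs)
    then obtain y ys where w': "w' = y # ys" by (cases w') auto
    have "x = y"
    proof (rule ccontr)
      assume "x \<noteq> y"
      then have "y \<in> set xs" "x \<in> set ys" using Cons.prems(3) by (auto simp: w')
      then have "R x y" "R y x" using Cons.prems(1,2) by (auto simp: w')
      then show False using trans irrefl by blast
    qed
    moreover have "x \<notin> set xs" "y \<notin> set ys"
      using Cons.prems(1,2) irrefl by (auto simp: w')
    then have "set xs = set ys" using Cons.prems(3) \<open>x = y\<close> by (auto simp: w')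
    ultimately show ?case using Cons by (simp add: w')
  qed simp
qed

lemma finite_signed_positions:
  assumes "is_abacus l A"
  shows "finite (signed_positions e A i)"
proof -
  obtain m1 m2 where A1: "A \<subseteq> UNIV \<times> {1..l}"
    and m1: "\<And>j \<beta>. j \<in> {1..l} \<Longrightarrow> \<beta> \<le> m1 \<Longrightarrow> (\<beta>, j) \<in> A"
    and m2: "\<And>j \<beta>. j \<in> {1..l} \<Longrightarrow> \<beta> \<ge> m2 \<Longrightarrow> (\<beta>, j) \<notin> A"
    using assms unfolding is_abacus_def by blast
  have in_rows: "j \<in> {1..l}" if "(\<beta>, j) \<in> A" for \<beta> j using A1 that by auto
  have bounds: "m1 - 1 \<le> \<beta> \<and> \<beta> \<le> m2 \<and> j \<in> {1..l}"
    if "(\<beta>, j) \<in> A \<and> (\<beta> + 1, j) \<notin> A \<or> (\<beta> + 1, j) \<in> A \<and> (\<beta>, j) \<notin> A" for \<beta> j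
  proof -
    have j: "j \<in> {1..l}" using that in_rows by blast
    have "\<not> \<beta> < m1 - 1" "\<not> m2 < \<beta>"
      using that m1[OF j, of \<beta>] m1[OF j, of "\<beta> + 1"] m2[OF j, of \<beta>] m2[OF j, of "\<beta> + 1"]
      by linarith+
    then show ?thesis using j by simp
  qed
  have "x \<in> ({m1 - 1..m2} \<times> {1..l}) \<times> {Plus, Minus}" if "x \<in> signed_positions e A i" for x
  proof -
    obtain \<beta> j p where x: "x = ((\<beta>, j), p)" by (metis surj_pair)
    then have "(\<beta>, j) \<in> A \<and> (\<beta> + 1, j) \<notin> A \<or> (\<beta> + 1, j) \<in> A \<and> (\<beta>, j) \<notin> A"
      using that by (auto simp: signed_positions_def)
    from bounds[OF this] show ?thesis by (cases p) (auto simp: x)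
  qed
  then have "signed_positions e A i \<subseteq> ({m1 - 1..m2} \<times> {1..l}) \<times> {Plus, Minus}" by blast
  then show ?thesis by (rule finite_subset) simp
qed

lemma signed_positions_sign_unique:
  "(b, p) \<in> signed_positions e A i \<Longrightarrow> (b, p') \<in> signed_positions e A i \<Longrightarrow> p = p'"
  by (auto simp: signed_positions_def)

lemma signature_sorted_set:
  assumes "is_abacus l A"
  shows "sorted_wrt (\<lambda>x y. (fst x, fst y) \<in> bead_less) (signature e A i)"
    and "set (signature e A i) = signed_positions e A i"
proof -
  let ?R = "\<lambda>x y :: bead \<times> sign. (fst x, fst y) \<in> bead_less"
  have "\<exists>!w. sorted_wrt ?R w \<and> set w = signed_positions e A i"
  proof (rule ex1_sorted_wrt[OF finite_signed_positions[OF assms]])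
    show "?R x z" if "?R x y" "?R y z" for x y z
      using trans_bead_less that by (rule transD)
    show "?R x y \<or> ?R y x"
      if "x \<in> signed_positions e A i" "y \<in> signed_positions e A i" "x \<noteq> y" for x y
    proof -
      have "fst x \<noteq> fst y"
        using that signed_positions_sign_unique by (metis prod.collapse)
      then show ?thesis using bead_less_linear by blast
    qed
  qed (rule bead_less_irrefl)
  from theI'[OF this]
  show "sorted_wrt ?R (signature e A i)" "set (signature e A i) = signed_positions e A i"
    unfolding signature_def by blast+
qed

lemma cancel_set: "cancel w w' \<Longrightarrow> set w' \<subseteq> set w"
  by (induction rule: cancel.induct) auto

lemma cancel_rtranclp_set: "cancel\<^sup>*\<^sup>* w w' \<Longrightarrow> set w' \<subseteq> set w"
  by (induction rule: rtranclp_induct) (use cancel_set in blast)+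

lemma cancel_has_Minus: "cancel w w' \<Longrightarrow> \<exists>x\<in>set w. snd x = Minus"
  by (induction rule: cancel.induct) auto

lemma cancel_rtranclp_Plus:
  assumes "cancel\<^sup>*\<^sup>* w w'" "\<forall>x\<in>set w. snd x = Plus"
  shows "w' = w"
  using assms(1)
proof (cases rule: converse_rtranclpE)
  case (step y)
  then show ?thesis using cancel_has_Minus[of w y] assms(2) by auto
qed simp

lemma good_bead_right_shiftable:
  assumes "is_abacus l A" "good_bead e A i (\<beta>, j)"
  shows "(\<beta>, j) \<in> A" "(\<beta> + 1, j) \<notin> A" "\<beta> mod int e = int i"
proof -
  obtain u v where "cancel\<^sup>*\<^sup>* (signature e A i) (u @ [((\<beta>, j), Plus)] @ v)"
    using assms(2) unfolding good_bead_def by blast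
  from cancel_rtranclp_set[OF this]
  have "((\<beta>, j), Plus) \<in> signed_positions e A i"
    using signature_sorted_set(2)[OF assms(1)] by auto
  then show "(\<beta>, j) \<in> A" "(\<beta> + 1, j) \<notin> A" "\<beta> mod int e = int i"
    by (auto simp: signed_positions_def)
qed

text \<open>Without minus signs nothing cancels, so the rightmost plus sign is the last letter.\<close>

lemma good_bead_iff_greatest:
  assumes A: "is_abacus l A" and plus: "\<And>x. x \<in> signed_positions e A i \<Longrightarrow> snd x = Plus"
  shows "good_bead e A i b \<longleftrightarrow> (b, Plus) \<in> signed_positions e A i \<and>
    (\<forall>x\<in>signed_positions e A i. fst x = b \<or> (fst x, b) \<in> bead_less)"
    (is "_ \<longleftrightarrow> ?rhs")
proof
  let ?w = "signature e A i"
  note w = signature_sorted_set[OF A, of e i]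
  have plus': "\<forall>x\<in>set ?w. snd x = Plus" using w(2) plus by simp
  show ?rhs if "good_bead e A i b"
  proof -
    obtain u v where c: "cancel\<^sup>*\<^sup>* ?w (u @ [(b, Plus)] @ v)"
      and v: "\<forall>x\<in>set v. snd x = Minus"
      using \<open>good_bead e A i b\<close> unfolding good_bead_def by blast
    have eq: "?w = u @ [(b, Plus)] @ v" using cancel_rtranclp_Plus[OF c plus'] by simp
    then have "v = []" using v plus' by (cases v) auto
    then have "signed_positions e A i = insert (b, Plus) (set u)"
      and "\<forall>x\<in>set u. (fst x, b) \<in> bead_less"
      using w by (auto simp: eq sorted_wrt_append)
    then show ?thesis by auto
  qed
  show "good_bead e A i b" if ?rhs
  proof -
    obtain u v where eq: "?w = u @ (b, Plus) # v"
      using \<open>?rhs\<close> w(2) by (metis split_list)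
    have "v = []"
    proof (rule ccontr)
      assume "v \<noteq> []"
      then have x: "hd v \<in> set v" by simp
      then have "(b, fst (hd v)) \<in> bead_less" using w(1) x by (auto simp: eq sorted_wrt_append)
      moreover have "hd v \<in> signed_positions e A i" using x w(2) by (auto simp: eq)
      ultimately show False
        using \<open>?rhs\<close> bead_less_asym bead_less_irrefl by metis
    qed
    then show ?thesis
      unfolding good_bead_def using plus' by (intro exI[of _ u] exI[of _ "[]"]) (auto simp: eq)
  qed
qed

section \<open>Depth in the crystal of affine type \<open>sl_e\<close>\<close>

text \<open>The only bead that can be left-shiftable is in column \<open>c + 2\<close> of row \<open>1\<close>, at position \<open>c + 1\<close>. Its
  residue differs from that of \<open>c\<close>, so there are only plus signs.\<close>

lemma signed_positions_gap_abacus_iff: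
  assumes e: "2 \<le> e" and c: "c < N" and l: "1 \<le> l" and i: "int i = c mod int e"
  shows "(b, p) \<in> signed_positions e (gap_abacus l s N (c + 1)) i \<longleftrightarrow>
    p = Plus \<and> (b = (c, 1) \<or> b = (N, 1) \<and> N mod int e = c mod int e \<or>
      (\<exists>j\<in>{2..l}. b = (s j, j) \<and> s j mod int e = c mod int e))"
proof -
  have ne: "(c + 1) mod int e \<noteq> c mod int e"
  proof
    assume "(c + 1) mod int e = c mod int e"
    then have "int e dvd (c + 1) - c" by (rule mod_eq_dvd_iff[THEN iffD1])
    then show False using e by (simp add: zdvd1_eq)
  qed
  obtain \<beta> j where b: "b = (\<beta>, j)" by (cases b)
  show ?thesis
  proof (cases p)
    case Plus
    show ?thesis
    proof (cases "j = 1")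
      case True
      have "(b, p) \<in> signed_positions e (gap_abacus l s N (c + 1)) i \<longleftrightarrow>
          \<beta> \<le> N \<and> \<beta> \<noteq> c + 1 \<and> (\<beta> = N \<or> \<beta> = c) \<and> \<beta> mod int e = c mod int e"
        using l by (auto simp: b True Plus signed_positions_def gap_abacus_iff i)
      also have "\<dots> \<longleftrightarrow> \<beta> = c \<or> \<beta> = N \<and> N mod int e = c mod int e"
        using ne c by auto
      finally show ?thesis by (auto simp: b True Plus)
    next
      case False
      have "(b, p) \<in> signed_positions e (gap_abacus l s N (c + 1)) i \<longleftrightarrow>
          1 \<le> j \<and> j \<le> l \<and> \<beta> = s j \<and> \<beta> mod int e = c mod int e"
        using False by (auto simp: b Plus signed_positions_def gap_abacus_iff i)
      then show ?thesis using False by (auto simp: b Plus)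
    qed
  next
    case Minus
    then show ?thesis
      using ne by (auto simp: add.commute b signed_positions_def gap_abacus_iff i split: if_splits)
  qed
qed

text \<open>Column \<open>c + 1\<close> does not exceed \<open>N\<close>, and \<open>(c, 1)\<close> is the good bead of \<open>G (c + 1)\<close>
  for the residue of \<open>c\<close>: the ends of rows with that residue are in columns at most \<open>c\<close>,
  where a tie with \<open>c\<close> is won by row \<open>1\<close>.\<close>

definition gap_moves :: "nat \<Rightarrow> nat \<Rightarrow> (nat \<Rightarrow> int) \<Rightarrow> int \<Rightarrow> int \<Rightarrow> bool" where
  "gap_moves e l s N c \<longleftrightarrow> c < N \<and>
     (\<forall>\<beta>\<in>insert N (s ` {2..l}). c < \<beta> \<longrightarrow> \<beta> mod int e \<noteq> c mod int e)"

lemma good_bead_gap_abacus_iff: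
  assumes e: "2 \<le> e" and c: "c < N" and l: "1 \<le> l" and i: "int i = c mod int e"
  shows "good_bead e (gap_abacus l s N (c + 1)) i (c, 1) \<longleftrightarrow> gap_moves e l s N c"
proof -
  let ?S = "signed_positions e (gap_abacus l s N (c + 1)) i"
  note sp = signed_positions_gap_abacus_iff[OF e c l i, of _ _ s]
  have "snd x = Plus" if "x \<in> ?S" for x using that by (cases x) (simp add: sp)
  then have "good_bead e (gap_abacus l s N (c + 1)) i (c, 1) \<longleftrightarrow>
      (\<forall>x\<in>?S. fst x = (c, 1) \<or> (fst x, (c, 1)) \<in> bead_less)"
    using sp by (subst good_bead_iff_greatest[OF is_abacus_gap_abacus]) auto
  also have "\<dots> \<longleftrightarrow> (\<forall>b p. (b, p) \<in> ?S \<longrightarrow> b = (c, 1) \<or> (b, (c, 1)) \<in> bead_less)"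
    by force
  also have "\<dots> \<longleftrightarrow> (N mod int e = c mod int e \<longrightarrow> ((N, 1), (c, 1)) \<in> bead_less) \<and>
      (\<forall>j\<in>{2..l}. s j mod int e = c mod int e \<longrightarrow> ((s j, j), (c, 1)) \<in> bead_less)"
    using c unfolding sp by fastforce
  also have "\<dots> \<longleftrightarrow> gap_moves e l s N c"
  proof -
    have "((N, 1), (c, 1)) \<notin> bead_less" using c by (simp add: bead_less_def)
    moreover have "((s j, j), (c, 1)) \<in> bead_less \<longleftrightarrow> \<not> c < s j" if "j \<in> {2..l}" for j
      using that by (auto simp: bead_less_def)
    ultimately show ?thesis using c unfolding gap_moves_def by blast
  qed
  finally show ?thesis .
qed

lemma sl_e_arrow_gap_abacus_iff:
  assumes e: "2 \<le> e" and l: "1 \<le> l"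
  shows "sl_e_arrow e l B (gap_abacus l s N c) \<longleftrightarrow>
    B = gap_abacus l s N (c + 1) \<and> gap_moves e l s N c"
proof
  let ?G = "gap_abacus l s N"
  assume "sl_e_arrow e l B (?G c)"
  then obtain i \<beta> j where B: "is_abacus l B" and good: "good_bead e B i (\<beta>, j)"
    and eq: "?G c = B - {(\<beta>, j)} \<union> {(\<beta> + 1, j)}"
    unfolding sl_e_arrow_def by blast
  note r = good_bead_right_shiftable[OF B good]
  have "(\<beta>, j) \<notin> ?G c" "(\<beta> + 1, j) \<in> ?G c" by (simp_all add: eq)
  then have j: "j = 1" and \<beta>: "\<beta> = c" and cN: "c < N"
    unfolding gap_abacus_iff by (cases "j = 1"; simp)+
  have "b \<in> B \<longleftrightarrow> b \<in> ?G (c + 1)" for b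
  proof -
    have "B = ?G c - {(\<beta> + 1, j)} \<union> {(\<beta>, j)}" using r eq by auto
    then have "b \<in> B \<longleftrightarrow> b \<in> ?G c \<and> b \<noteq> (c + 1, 1) \<or> b = (c, 1)"
      by (auto simp: j \<beta>)
    also have "\<dots> \<longleftrightarrow> b \<in> ?G (c + 1)"
      using cN l by (cases b) (auto simp: gap_abacus_iff)
    finally show ?thesis .
  qed
  then have Beq: "B = ?G (c + 1)" by blast
  moreover have "gap_moves e l s N c"
    using good_bead_gap_abacus_iff[OF e cN l, of i s] good r(3) by (simp add: Beq j \<beta>)
  ultimately show "B = ?G (c + 1) \<and> gap_moves e l s N c" ..
next
  let ?G = "gap_abacus l s N"
  assume B: "B = ?G (c + 1) \<and> gap_moves e l s N c"
  then have cN: "c < N" by (simp add: gap_moves_def)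
  have i: "int (nat (c mod int e)) = c mod int e" using e by simp
  have "c mod int e < int e" using e by simp
  then have "nat (c mod int e) < e" using i by linarith
  moreover have "good_bead e B (nat (c mod int e)) (c, 1)"
    using good_bead_gap_abacus_iff[OF e cN l i, of s] B by simp
  moreover have "?G c = (B - {(c, 1)}) \<union> {(c + 1, 1)}"
  proof -
    have "b \<in> ?G c \<longleftrightarrow> b \<in> (B - {(c, 1)}) \<union> {(c + 1, 1)}" for b
      using cN l B by (cases b) (auto simp: gap_abacus_iff)
    then show ?thesis by blast
  qed
  ultimately show "sl_e_arrow e l B (?G c)"
    unfolding sl_e_arrow_def using B is_abacus_gap_abacus by blast
qed

lemma sl_e_arrow_relpowp_gap_abacus_iff:
  assumes "2 \<le> e" "1 \<le> l"
  shows "(sl_e_arrow e l ^^ d) B (gap_abacus l s N c) \<longleftrightarrow>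
    B = gap_abacus l s N (c + int d) \<and> (\<forall>i<d. gap_moves e l s N (c + int i))"
proof (induction d arbitrary: c)
  case (Suc d)
  have "(sl_e_arrow e l ^^ Suc d) B (gap_abacus l s N c) \<longleftrightarrow>
      (sl_e_arrow e l ^^ d) B (gap_abacus l s N (c + 1)) \<and> gap_moves e l s N c"
    by (auto simp: OO_def sl_e_arrow_gap_abacus_iff[OF assms])
  also have "\<dots> \<longleftrightarrow> B = gap_abacus l s N (c + int (Suc d)) \<and>
      (\<forall>i<Suc d. gap_moves e l s N (c + int i))"
    unfolding Suc.IH All_less_Suc2 by (auto simp: algebra_simps)
  finally show ?case .
qed simp

lemma sl_e_depth_gap_abacus:
  assumes el: "2 \<le> e" "1 \<le> l"
    and moves: "\<And>i. i < d \<Longrightarrow> gap_moves e l s N (c + int i)"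
    and stop: "\<not> gap_moves e l s N (c + int d)"
  shows "sl_e_depth e l (gap_abacus l s N c) = d"
  unfolding sl_e_depth_def
proof (rule the_equality)
  let ?G = "gap_abacus l s N"
  have source: "sl_e_source e l (?G (c + int d')) \<longleftrightarrow> \<not> gap_moves e l s N (c + int d')" for d'
    unfolding sl_e_source_def using is_abacus_gap_abacus sl_e_arrow_gap_abacus_iff[OF el] by blast
  have path: "(sl_e_arrow e l ^^ d) (?G (c + int d)) (?G c)"
    using sl_e_arrow_relpowp_gap_abacus_iff[OF el] moves by blast
  then have "equivclp (sl_e_arrow e l) (?G (c + int d)) (?G c)"
    by (intro predicate2D[OF rtranlcp_le_equivclp] relpowp_imp_rtranclp)
  then show "\<exists>B. sl_e_source e l B \<and> equivclp (sl_e_arrow e l) B (?G c) \<and>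
      (sl_e_arrow e l ^^ d) B (?G c)"
    using path source stop by blast
  fix d' assume "\<exists>B. sl_e_source e l B \<and> equivclp (sl_e_arrow e l) B (?G c) \<and>
      (sl_e_arrow e l ^^ d') B (?G c)"
  then obtain B where "sl_e_source e l B" "(sl_e_arrow e l ^^ d') B (?G c)" by blast
  then have "\<not> gap_moves e l s N (c + int d')" and "\<forall>i<d'. gap_moves e l s N (c + int i)"
    unfolding sl_e_arrow_relpowp_gap_abacus_iff[OF el] using source[of d'] by simp_all
  then show "d' = d" using moves stop by (metis linorder_neqE_nat)
qed

theorem theoremB:
  fixes e l n q r :: nat and s :: "nat \<Rightarrow> int" and m :: int
  assumes "e \<ge> 2" and "l \<ge> 2"
    and "s 1 = int n - int e - 1"
    and "n = q * e + r" and "r < e"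
    and "m = Min ({int n mod int e} \<union> {s j mod int e | j. 2 \<le> j \<and> j \<le> l \<and> s j \<ge> 0})"
  shows "sl_inf_depth e l (abacus_of l (Triv n) s) =
           (if \<forall>j\<in>{2..l}. s j < 0 then q else 0) \<and>
         int (sl_e_depth e l (abacus_of l (Triv n) s)) =
           (if \<forall>j\<in>{2..l}. s j < 0 then int r else m)"
proof
  have l: "1 \<le> l" and e: "0 < e" using assms(1,2) by auto
  let ?N = "int n - int e"
  let ?M = "{int n mod int e} \<union> {s j mod int e | j. 2 \<le> j \<and> j \<le> l \<and> s j \<ge> 0}"
  have A: "abacus_of l (Triv n) s = gap_abacus l s ?N (- int e)"
    by (rule abacus_of_Triv[where s = s, OF l assms(3)])
  have N: "?N = int e * (int q - 1) + int r" by (simp add: assms(4) algebra_simps)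
  show "sl_inf_depth e l (abacus_of l (Triv n) s) = (if \<forall>j\<in>{2..l}. s j < 0 then q else 0)"
  proof (cases "\<forall>j\<in>{2..l}. s j < 0")
    case True
    then show ?thesis
      using sl_inf_depth_no_bead_right_of_origin[where s = s, OF l assms(5) _ N] by (simp add: A)
  next
    case False
    then have "\<exists>j\<in>{2..l}. 0 \<le> s j" by (auto simp: not_less)
    then have "sl_inf_depth e l (gap_abacus l s ?N (- int e)) = 0"
      by (intro sl_inf_depth_highest_weight sl_inf_highest_weight_bead_right_of_origin[OF l e])
    then show ?thesis using False by (simp only: A if_False)
  qed
  have nr: "int n mod int e = int r" using assms(5) by (simp add: assms(4) flip: of_nat_mod)
  have "{s j mod int e | j. 2 \<le> j \<and> j \<le> l \<and> s j \<ge> 0} \<subseteq> (\<lambda>j. s j mod int e) ` {2..l}" by auto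
  then have fin: "finite ?M" using finite_subset by blast
  have mM: "m \<in> ?M" unfolding assms(6) by (rule Min_in) (use fin in auto)
  have m_le: "m \<le> x" if "x \<in> ?M" for x unfolding assms(6) by (rule Min_le) (use fin that in auto)
  have "0 \<le> m" using mM e by auto
  then obtain d where m: "m = int d" by (rule nonneg_int_cases)
  have mr: "m \<le> int r" using m_le[of "int r"] nr by simp
  have mod_c: "(- int e + int i) mod int e = int i" if "i < e" for i
    using that by (simp add: mod_add_left_eq[of "- int e" "int e", symmetric])
  have Nmod: "?N mod int e = int r" using nr by (simp add: mod_diff_right_eq[of _ "int e" "int e", symmetric])
  have "sl_e_depth e l (gap_abacus l s ?N (- int e)) = d"
  proof (rule sl_e_depth_gap_abacus[OF assms(1) l])
    fix i assume "i < d"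
    then have i: "int i < m" "i < e" "i < r" using m mr assms(5) by linarith+
    \<comment> \<open>Negative \<open>s j\<close> never stop the gap: it stays in the columns \<open>-e, \<dots>, -1\<close>, so a larger column
      of the same residue is nonnegative.\<close>
    have "s j mod int e \<noteq> int i" if j: "j \<in> {2..l}" "- int e + int i < s j" for j
    proof (cases "0 \<le> s j")
      case True
      then have "m \<le> s j mod int e" using j by (intro m_le) auto
      then show ?thesis using i by simp
    next
      case False
      then have "s j mod int e = s j + int e"
        using j(2) by (intro mod_pos_pos_trivial[of "s j + int e" "int e", simplified]) auto
      then show ?thesis using j(2) by simp
    qed
    moreover have "- int e + int i < ?N"
      using i by (simp add: assms(4) add_nonneg_pos add_strict_increasing2)
    ultimately show "gap_moves e l s ?N (- int e + int i)"
      using i by (auto simp: gap_moves_def mod_c[OF i(2)] nr)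
  next
    have "d < e" using m mr assms(5) by linarith
    show "\<not> gap_moves e l s ?N (- int e + int d)"
    proof
      assume "gap_moves e l s ?N (- int e + int d)"
      then have c: "- int e + m < ?N"
        and no: "\<And>\<beta>. \<beta> \<in> insert ?N (s ` {2..l}) \<Longrightarrow> - int e + m < \<beta> \<Longrightarrow> \<beta> mod int e \<noteq> m"
        unfolding gap_moves_def mod_c[OF \<open>d < e\<close>] m by blast+
      have "m \<noteq> int r" using no[of ?N] c Nmod by blast
      then obtain j where j: "j \<in> {2..l}" "m = s j mod int e" "0 \<le> s j"
        using mM nr by auto
      have "- int e + m < s j" using j(3) m \<open>d < e\<close> by linarith
      then show False using no[of "s j"] j(1,2) by blast
    qed
  qed
  moreover have "m = int r" if "\<forall>j\<in>{2..l}. s j < 0"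
    using mM nr that by force
  ultimately show "int (sl_e_depth e l (abacus_of l (Triv n) s)) =
      (if \<forall>j\<in>{2..l}. s j < 0 then int r else m)"
    by (simp add: A m)
qed

end
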